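(* Let $A,h,u,\Gamma,f,g,\Phi,\Lambda,p,W,\mathcal{C}$ be as described in the context (in particular $\Lambda$ is singular, so $p\ge 1$), and assume the following. (1) There exist positive constants $K,\alpha$ such that $\|\Phi(t)\Phi^{-1}(s)\|\le Ke^{-\alpha(t-s)}$ for all $t\ge s\ge 0$. (2) For any compact subset $S\subset\mathbb{R}^n$, $\frac{\partial f}{\partial x}$ is uniformly continuous on $[0,\infty)\times S$, and $\sup_{t\ge 0}\left\|\frac{\partial f}{\partial x}(t,0)\right\|<\infty$. (3) For any compact subset $S\subset\mathbb{R}^n$, $\frac{\partial g}{\partial x}$ is uniformly continuous on $[0,\infty)\times S$, and $\int_0^\infty\left\|\frac{\partial g}{\partial x}(t,0)\right\|dt<\infty$. (4) For all $\eta\in\mathcal{C}$, $\int_0^\infty|g(t,\eta(t))|\,dt<\infty$. (5) There exists an integrable $s:[0,\infty)\to\mathbb{R}$ such that $\left\|\frac{\partial g}{\partial x}(t,x_1)-\frac{\partial g}{\partial x}(t,x_2)\right\|\le s(t)|x_1-x_2|$ for all $t\ge 0$ and $x_1,x_2\in\mathbb{R}^n$. For $y\in\mathbb{R}^n$ write $x_y(t)=\Phi(t)y+\Phi(t)\int_0^t\Phi^{-1}(s)h(s)\,ds$. Suppose there exists $y\in\ker(\Lambda)$ such that $$W^T\left[\int_0^\infty g(t,x_y(t))\,dt-\Gamma\left(\Phi(\cdot)\int_0^{\cdot}\Phi^{-1}(s)f(s,x_y(s))\,ds\right)\right]=0$$ and such that the map $\phi:\ker(\Lambda)\to\mathbb{R}^p$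 given by $$\phi(w)=W^T\left[\int_0^\infty\frac{\partial g}{\partial x}(t,x_y(t))\Phi(t)\,dt-\Gamma\left(\Phi(\cdot)\int_0^{\cdot}\Phi^{-1}(s)\frac{\partial f}{\partial x}(s,x_y(s))\Phi(s)\,ds\right)\right]w$$ is a bijection from $\ker(\Lambda)\subset\mathbb{R}^n$ onto $\mathbb{R}^p$. Then there exists $\varepsilon_0>0$ such that for all $|\varepsilon|\le\varepsilon_0$ the boundary value problem $$x'(t)-A(t)x(t)=h(t)+\varepsilon f(t,x(t)),\qquad \Gamma(x)=u+\varepsilon\int_0^\infty g(t,x(t))\,dt$$ on $[0,\infty)$ is guaranteed a solution $x_\varepsilon$. Moreover $\|x_\varepsilon-x_y\|_\infty\to 0$ as $\varepsilon\to 0$.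
   Context: $\mathcal{C}$ is the Banach space of bounded continuous functions from $[0,\infty)$ into $\mathbb{R}^n$ with norm $\|x\|_\infty=\sup_{t\ge0}|x(t)|$, where $|\cdot|$ is the Euclidean norm; $\|\cdot\|$ is the operator norm on $n\times n$ real matrices. $A$ is a continuous $n\times n$ real matrix-valued function on $[0,\infty)$; $h\in\mathcal{C}$; $u\in\mathbb{R}^n$; $f,g:\mathbb{R}^{n+1}=\mathbb{R}\times\mathbb{R}^n\to\mathbb{R}^n$ are continuously differentiable maps of $(t,x)$, and $\frac{\partial f}{\partial x},\frac{\partial g}{\partial x}$ denote the Jacobian matrices in the variable $x\in\mathbb{R}^n$; $\Gamma:\mathcal{C}\to\mathbb{R}^n$ is a bounded linear map. When $\Gamma$ is applied to a matrix-valued function, it is applied columnwise, giving a matrix. $\Phi(t)$ is the fundamental matrix for $x'(t)-A(t)x(t)=0$ with $\Phi(0)=I$, and $\Phi_i$ is its $i$th column. $\Lambda$ is the $n\times n$ matrix $[\Gamma(\Phi_1(\cdot))\,|\,\cdots\,|\,\Gamma(\Phi_n(\cdot))]$. (The columns $\Phi_i$ lie in $\mathcal{C}$ by hypothesis (1).) $p$ is the dimension of $\ker(\Lambda)$, and $\Lambda$ is assumed singular, so $p\ge1$. $W$ is an $n\times p$ matrix whose columns form a basis of $\ker(\Lambda^T)$. Standing assumption: $h$ and $u$ are such that the linear problem $x'(t)-A(t)x(t)=h(t)$, $\Gamma(x)=u$ has a solution, equivalently $W^T\left[u-\Gamma\left(\Phi(\cdot)\int_0^{\cdot}\Phi^{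-1}(s)h(s)\,ds\right)\right]=0$.
   Formalization: The condition y∈ker(Λ) is replaced by Λy=u−Γ(Φ∫Φ^{-1}h), i.e. Γ(x_y)=u, which the claimed convergence forces (the claim fails otherwise); also Φ∫Φ^{-1}f(s,x_y(s))ds is explicitly assumed to lie in 𝒞 so that Γ of it is defined. *)

theory Defs
  imports "HOL-Analysis.Analysis"
begin

text \<open>Functions on the half-line \<open>[0, \<infinity>)\<close> are represented by functions on \<^typ>\<open>real\<close> whose values at
  negative arguments are irrelevant.\<close>

definition bdd_cont :: "(real \<Rightarrow> 'a::real_normed_vector) set" where
  "bdd_cont = {x. continuous_on {0..} x \<and> bounded (x ` {0..})}"

definition sup_norm :: "(real \<Rightarrow> 'a::real_normed_vector) \<Rightarrow> real" where
  "sup_norm x = (SUP t\<in>{0..}. norm (x t))"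

text \<open>The function type carries no vector space structure, so linearity is spelled out. The bound
  forces \<open>\<Gamma> x\<close>, for \<open>x\<close> in \<^const>\<open>bdd_cont\<close>, to depend only on the values of \<open>x\<close> on
  \<open>[0, \<infinity>)\<close>; nothing is known about \<open>\<Gamma> x\<close> for other \<open>x\<close>.\<close>

definition bounded_linear_on_bdd_cont ::
  "((real \<Rightarrow> 'a::real_normed_vector) \<Rightarrow> 'b::real_normed_vector) \<Rightarrow> bool" where
  "bounded_linear_on_bdd_cont \<Gamma> \<longleftrightarrow>
     (\<forall>x\<in>bdd_cont. \<forall>z\<in>bdd_cont. \<Gamma> (\<lambda>t. x t + z t) = \<Gamma> x + \<Gamma> z) \<and>
     (\<forall>c. \<forall>x\<in>bdd_cont. \<Gamma> (\<lambda>t. c *\<^sub>R x t) = c *\<^sub>R \<Gamma> x) \<and>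
     (\<exists>B. \<forall>x\<in>bdd_cont. norm (\<Gamma> x) \<le> B * sup_norm x)"

definition columnwise ::
  "((real \<Rightarrow> real^'n) \<Rightarrow> real^'m) \<Rightarrow> (real \<Rightarrow> real^'k^'n) \<Rightarrow> real^'k^'m" where
  "columnwise \<Gamma> M = (\<chi> i j. \<Gamma> (\<lambda>t. column j (M t)) $ i)"

abbreviation op_norm :: "real^'n^'m \<Rightarrow> real" where
  "op_norm M \<equiv> onorm ((*v) M)"

definition mat_kernel :: "real^'n^'m \<Rightarrow> (real^'n) set" where
  "mat_kernel M = {v. M *v v = 0}"

definition columns_basis_of :: "real^'p^'n \<Rightarrow> (real^'n) set \<Rightarrow> bool" where
  "columns_basis_of W V \<longleftrightarrow>
     inj (\<lambda>j. column j W) \<and> independent (columns W) \<and> span (columns W) = V"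

definition cont_differentiable ::
  "('a::real_normed_vector \<Rightarrow> 'b::real_normed_vector) \<Rightarrow> bool" where
  "cont_differentiable f \<longleftrightarrow>
     (\<exists>F :: 'a \<Rightarrow> 'a \<Rightarrow>\<^sub>L 'b. (\<forall>z. (f has_derivative blinfun_apply (F z)) (at z)) \<and>
        continuous_on UNIV F)"

definition jac_x :: "(real \<times> (real^'n) \<Rightarrow> real^'m) \<Rightarrow> real \<Rightarrow> real^'n \<Rightarrow> real^'n^'m" where
  "jac_x f t x = jacobian (\<lambda>z. f (t, z)) (at x)"

text \<open>\<open>x'(t) - A(t) x(t) = k(t)\<close> on \<open>[0, \<infinity>)\<close>, with the one-sided derivative at \<open>0\<close>.\<close>

definition solves_lin_ode ::
  "(real \<Rightarrow> real^'n^'n) \<Rightarrow> (real \<Rightarrow> real^'n) \<Rightarrow> (real \<Rightarrow> real^'n) \<Rightarrow> bool" where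
  "solves_lin_ode A k x \<longleftrightarrow>
     (\<forall>t\<ge>0. (x has_vector_derivative (A t *v x t + k t)) (at t within {0..}))"

definition fundamental_matrix ::
  "(real \<Rightarrow> real^'n^'n) \<Rightarrow> (real \<Rightarrow> real^'n^'n) \<Rightarrow> bool" where
  "fundamental_matrix A \<Phi> \<longleftrightarrow> \<Phi> 0 = mat 1 \<and>
     (\<forall>t\<ge>0. (\<Phi> has_vector_derivative (A t ** \<Phi> t)) (at t within {0..}))"

definition duhamel ::
  "(real \<Rightarrow> real^'n^'n) \<Rightarrow> (real \<Rightarrow> real^'n) \<Rightarrow> real \<Rightarrow> real^'n" where
  "duhamel \<Phi> k t = \<Phi> t *v integral {0..t} (\<lambda>s. matrix_inv (\<Phi> s) *v k s)"

definition duhamel_mat ::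
  "(real \<Rightarrow> real^'n^'n) \<Rightarrow> (real \<Rightarrow> real^'k^'n) \<Rightarrow> real \<Rightarrow> real^'k^'n" where
  "duhamel_mat \<Phi> M t = \<Phi> t ** integral {0..t} (\<lambda>s. matrix_inv (\<Phi> s) ** M s)"

end

theory Submission
  imports Defs
begin

text \<open>A Lyapunov-Schmidt reduction. Writing a solution as \<open>x\<^sub>y + z\<close>, put
  \<open>E z = \<integral> g(t, x\<^sub>y + z) dt - \<Gamma> (D z)\<close>, where \<open>D z\<close> is the Duhamel integral of \<open>f(t, x\<^sub>y + z)\<close>.
  For \<open>\<epsilon> \<noteq> 0\<close> the boundary value problem says that \<open>z = \<Phi> w + \<epsilon> D z\<close> for some vector \<open>w\<close> with
  \<open>\<Lambda> w = \<epsilon> E z\<close>. It suffices to find \<open>z\<close> and \<open>w\<^sub>0 \<in> ker \<Lambda>\<close> with \<open>W\<^sup>T E z = 0\<close>, so that \<open>E z\<close> is in the range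
  of \<open>\<Lambda>\<close>, and \<open>z = \<Phi> w\<^sub>0 + \<epsilon> (\<Phi> L (E z) + D z)\<close>, where \<open>L\<close> is a right inverse of \<open>\<Lambda>\<close> on its range.
  Both \<open>E\<close> and \<open>D\<close> are strictly differentiable at \<open>0\<close> in the Banach space of bounded continuous
  functions, and the derivative of \<open>W\<^sup>T E\<close> along \<open>w \<mapsto> \<Phi> w\<close> is the bijection \<open>\<phi>\<close>, so a contraction
  argument applies.\<close>

section \<open>Strict differentiability and bifurcation\<close>

text \<open>Strict differentiability at the single point 0: the remainder \<open>F - D\<close> has
  an arbitrarily small Lipschitz constant on small balls. This is what a contraction argument
  consumes, and it needs no derivative at other points.\<close>

definition strict_derivative_at_0 ::
  "('a::real_normed_vector \<Rightarrow> 'b::real_normed_vector) \<Rightarrow> ('a \<Rightarrow> 'b) \<Rightarrow> bool" where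
  "strict_derivative_at_0 F D \<longleftrightarrow> bounded_linear D \<and>
     (\<forall>e>0. \<exists>r>0. \<forall>x y. norm x \<le> r \<longrightarrow> norm y \<le> r \<longrightarrow>
        norm (F x - F y - D (x - y)) \<le> e * norm (x - y))"

lemma strict_derivative_at_0E:
  assumes "strict_derivative_at_0 F D" "e > 0"
  obtains r where "r > 0"
    "\<And>x y. norm x \<le> r \<Longrightarrow> norm y \<le> r \<Longrightarrow> norm (F x - F y - D (x - y)) \<le> e * norm (x - y)"
  using assms unfolding strict_derivative_at_0_def by blast

lemma strict_derivative_at_0_add:
  assumes F: "strict_derivative_at_0 F D" and G: "strict_derivative_at_0 G E"
  shows "strict_derivative_at_0 (\<lambda>x. F x + G x) (\<lambda>x. D x + E x)"
  unfolding strict_derivative_at_0_def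
proof (intro conjI allI impI)
  show "bounded_linear (\<lambda>x. D x + E x)"
    using F G by (auto simp: strict_derivative_at_0_def intro: bounded_linear_add)
  fix e :: real assume "e > 0"
  then have e: "e/2 > 0" by simp
  obtain r1 where r1: "r1 > 0" "\<And>x y. norm x \<le> r1 \<Longrightarrow> norm y \<le> r1 \<Longrightarrow>
      norm (F x - F y - D (x - y)) \<le> e/2 * norm (x - y)"
    using strict_derivative_at_0E[OF F e] by blast
  obtain r2 where r2: "r2 > 0" "\<And>x y. norm x \<le> r2 \<Longrightarrow> norm y \<le> r2 \<Longrightarrow>
      norm (G x - G y - E (x - y)) \<le> e/2 * norm (x - y)"
    using strict_derivative_at_0E[OF G e] by blast
  have "norm (F x + G x - (F y + G y) - (D (x - y) + E (x - y))) \<le> e * norm (x - y)"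
    if "norm x \<le> min r1 r2" "norm y \<le> min r1 r2" for x y
  proof -
    have "norm (F x + G x - (F y + G y) - (D (x - y) + E (x - y)))
        = norm ((F x - F y - D (x - y)) + (G x - G y - E (x - y)))"
      by (rule arg_cong[of _ _ norm]) (simp add: algebra_simps)
    also have "\<dots> \<le> e/2 * norm (x - y) + e/2 * norm (x - y)"
      using that by (intro order.trans[OF norm_triangle_ineq] add_mono r1 r2) auto
    finally show ?thesis by (simp add: algebra_simps)
  qed
  then show "\<exists>r>0. \<forall>x y. norm x \<le> r \<longrightarrow> norm y \<le> r \<longrightarrow>
      norm (F x + G x - (F y + G y) - (D (x - y) + E (x - y))) \<le> e * norm (x - y)"
    using r1(1) r2(1) by (intro exI[of _ "min r1 r2"]) auto
qed

lemma strict_derivative_at_0_compose_linear: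
  assumes L: "bounded_linear L" and F: "strict_derivative_at_0 F D"
  shows "strict_derivative_at_0 (\<lambda>x. L (F x)) (\<lambda>x. L (D x))"
  unfolding strict_derivative_at_0_def
proof (intro conjI allI impI)
  interpret L: bounded_linear L by fact
  show "bounded_linear (\<lambda>x. L (D x))"
    using F L by (auto simp: strict_derivative_at_0_def intro: bounded_linear_compose)
  obtain B where B: "B > 0" "\<And>x. norm (L x) \<le> norm x * B"
    using L.pos_bounded by blast
  fix e :: real assume "e > 0"
  with B have "e / B > 0" by simp
  then obtain r where r: "r > 0" "\<And>x y. norm x \<le> r \<Longrightarrow> norm y \<le> r \<Longrightarrow>
      norm (F x - F y - D (x - y)) \<le> e / B * norm (x - y)"
    using strict_derivative_at_0E[OF F] by blast
  have "norm (L (F x) - L (F y) - L (D (x - y))) \<le> e * norm (x - y)"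
    if "norm x \<le> r" "norm y \<le> r" for x y
  proof -
    have "norm (L (F x) - L (F y) - L (D (x - y))) \<le> norm (F x - F y - D (x - y)) * B"
      using B(2)[of "F x - F y - D (x - y)"] by (simp add: L.diff)
    also have "\<dots> \<le> e / B * norm (x - y) * B"
      using r(2)[OF that] B(1) by (intro mult_right_mono) auto
    finally show ?thesis using B(1) by simp
  qed
  with r(1) show "\<exists>r>0. \<forall>x y. norm x \<le> r \<longrightarrow> norm y \<le> r \<longrightarrow>
      norm (L (F x) - L (F y) - L (D (x - y))) \<le> e * norm (x - y)"
    by blast
qed

lemma strict_derivative_at_0_diff:
  assumes F: "strict_derivative_at_0 F D" and G: "strict_derivative_at_0 G E"
  shows "strict_derivative_at_0 (\<lambda>x. F x - G x) (\<lambda>x. D x - E x)"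
  using strict_derivative_at_0_add[OF F
      strict_derivative_at_0_compose_linear[OF bounded_linear_minus[OF bounded_linear_ident] G]]
  by simp

text \<open>The tolerance 1 for the remainder plus an operator bound \<open>B\<close> for
  \<open>D\<close> gives the constant \<open>1 + B\<close>.\<close>

lemma strict_derivative_at_0_lipschitz:
  assumes "strict_derivative_at_0 F D"
  obtains r L where "r > 0" "L > 0"
    "\<And>x y. norm x \<le> r \<Longrightarrow> norm y \<le> r \<Longrightarrow> norm (F x - F y) \<le> L * norm (x - y)"
proof -
  obtain r where r: "r > 0" "\<And>x y. norm x \<le> r \<Longrightarrow> norm y \<le> r \<Longrightarrow>
      norm (F x - F y - D (x - y)) \<le> 1 * norm (x - y)"
    using strict_derivative_at_0E[OF assms zero_less_one] by blast
  obtain B where B: "B > 0" "\<And>x. norm (D x) \<le> norm x * B"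
    using assms bounded_linear.pos_bounded unfolding strict_derivative_at_0_def by blast
  have "norm (F x - F y) \<le> (1 + B) * norm (x - y)" if "norm x \<le> r" "norm y \<le> r" for x y
    using r(2)[OF that] B(2)[of "x - y"] norm_triangle_sub[of "F x - F y" "D (x - y)"]
    by (simp add: algebra_simps)
  with r(1) B(1) show ?thesis by (intro that[of r "1 + B"]) auto
qed

text \<open>Applying \<open>H'\<close> to a fixed point \<open>z\<close> of
  \<open>z \<mapsto> S (H' z - H z - \<epsilon> H' (T z)) + \<epsilon> T z\<close> yields \<open>H z = 0\<close>, because \<open>H' \<circ> S = id\<close>. Near \<open>0\<close> and
  for small \<open>\<epsilon>\<close> this map is a contraction, as \<open>H' - H\<close> has a small Lipschitz constant there.\<close>

lemma bifurcation_from_zero: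
  fixes H :: "'a::{real_normed_vector,complete_space} \<Rightarrow> 'b::real_normed_vector" and T :: "'a \<Rightarrow> 'a"
  assumes H: "strict_derivative_at_0 H H'" and H0: "H 0 = 0"
    and T: "strict_derivative_at_0 T T'"
    and S: "bounded_linear S" "\<And>q. H' (S q) = q"
  shows "\<exists>\<epsilon>\<^sub>0>0. \<exists>C. \<forall>\<epsilon>. \<bar>\<epsilon>\<bar> \<le> \<epsilon>\<^sub>0 \<longrightarrow>
    (\<exists>z q. norm z \<le> C * \<bar>\<epsilon>\<bar> \<and> H z = 0 \<and> z = S q + \<epsilon> *\<^sub>R T z)"
proof -
  interpret S: bounded_linear S by fact
  interpret H': bounded_linear H' using H by (simp add: strict_derivative_at_0_def)
  obtain M where M: "M > 0" "\<And>q. norm (S q) \<le> norm q * M"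
    using S.pos_bounded by blast
  \<comment> \<open>Since \<open>S\<close> is a right inverse of \<open>H'\<close>, the map
    \<open>z - S (H' z)\<close> projects onto the kernel of \<open>H'\<close>. Collecting the terms
    with \<epsilon> in the fixed point map leaves exactly \<epsilon> times \<open>U\<close>.\<close>
  define U where "U z = T z - S (H' (T z))" for z
  have "bounded_linear (\<lambda>z. z - S (H' z))"
    by (intro bounded_linear_sub bounded_linear_ident
        bounded_linear_compose[OF S(1) H'.bounded_linear_axioms])
  then have "strict_derivative_at_0 U (\<lambda>z. T' z - S (H' (T' z)))"
    unfolding U_def by (rule strict_derivative_at_0_compose_linear[OF _ T])
  then obtain r1 L where r1: "r1 > 0" "L > 0"
    "\<And>x y. norm x \<le> r1 \<Longrightarrow> norm y \<le> r1 \<Longrightarrow> norm (U x - U y) \<le> L * norm (x - y)"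
    using strict_derivative_at_0_lipschitz by blast
  \<comment> \<open>\<open>M\<close> bounds \<open>S\<close>, so this tolerance gives
    \<open>S (H' z - H z)\<close> the Lipschitz constant 1/4 near 0.\<close>
  have "1 / (4 * M) > 0" using M(1) by simp
  then obtain r2 where r2: "r2 > 0"
    "\<And>x y. norm x \<le> r2 \<Longrightarrow> norm y \<le> r2 \<Longrightarrow>
      norm (H x - H y - H' (x - y)) \<le> 1 / (4 * M) * norm (x - y)"
    using strict_derivative_at_0E[OF H] by blast
  define r where "r = min r1 r2"
  have r: "r > 0" using r1(1) r2(1) by (simp add: r_def)
  \<comment> \<open>The first bound gives the \<epsilon> term Lipschitz constant 1/4, hence 1/2 in
    total. The second keeps the image of 0 within \<open>r/2\<close>, so the ball of radius
    \<open>r\<close> is mapped into itself; the added 1 covers \<open>U 0 = 0\<close>.\<close>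
  define \<epsilon>\<^sub>0 where "\<epsilon>\<^sub>0 = min (1 / (4 * L)) (r / (2 * (norm (U 0) + 1)))"
  have U0: "2 * (norm (U 0) + 1) > 0" by (smt (verit) norm_ge_zero)
  have \<epsilon>\<^sub>0: "\<epsilon>\<^sub>0 > 0" using r1(2) r U0 by (simp add: \<epsilon>\<^sub>0_def)
  show ?thesis
  proof (rule exI[of _ "\<epsilon>\<^sub>0"], intro conjI exI[of _ "2 * norm (U 0)"] allI impI \<epsilon>\<^sub>0)
    fix \<epsilon> :: real assume \<epsilon>: "\<bar>\<epsilon>\<bar> \<le> \<epsilon>\<^sub>0"
    define N where "N z = S (H' z - H z) + \<epsilon> *\<^sub>R U z" for z
    have \<epsilon>L: "\<bar>\<epsilon>\<bar> * L \<le> 1/4"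
      using \<epsilon> r1(2) by (simp add: \<epsilon>\<^sub>0_def pos_le_divide_eq algebra_simps)
    have "\<bar>\<epsilon>\<bar> * (2 * (norm (U 0) + 1)) \<le> r"
      using \<epsilon> U0 by (simp add: \<epsilon>\<^sub>0_def pos_le_divide_eq)
    then have \<epsilon>U: "\<bar>\<epsilon>\<bar> * norm (U 0) \<le> r/2"
      by (simp add: algebra_simps)
    have lip: "norm (N x - N y) \<le> 1/2 * norm (x - y)" if "norm x \<le> r" "norm y \<le> r" for x y
    proof -
      have "N x - N y = - S (H x - H y - H' (x - y)) + \<epsilon> *\<^sub>R (U x - U y)"
        by (simp add: N_def S.add S.diff H'.diff algebra_simps)
      also have "norm \<dots> \<le> norm (H x - H y - H' (x - y)) * M + \<bar>\<epsilon>\<bar> * norm (U x - U y)"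
        by (rule order.trans[OF norm_triangle_ineq]) (simp add: M(2))
      also have "\<dots> \<le> 1 / (4 * M) * norm (x - y) * M + \<bar>\<epsilon>\<bar> * (L * norm (x - y))"
        using that M(1) by (intro add_mono mult_right_mono mult_left_mono r1 r2) (auto simp: r_def)
      also have "\<dots> \<le> 1/4 * norm (x - y) + 1/4 * norm (x - y)"
        using M(1) mult_right_mono[OF \<epsilon>L norm_ge_zero[of "x - y"]] by (simp add: algebra_simps)
      finally show ?thesis by simp
    qed
    have N0: "norm (N 0) = \<bar>\<epsilon>\<bar> * norm (U 0)" by (simp add: N_def H0)
    have "\<exists>!z\<in>cball 0 r. N z = z"
    proof (rule Banach_fix[where c = "1/2"])
      show "N ` cball 0 r \<subseteq> cball 0 r"
      proof clarsimp
        fix z :: 'a assume z: "norm z \<le> r"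
        have "norm (N z) \<le> norm (N z - N 0) + norm (N 0)"
          using norm_triangle_ineq[of "N z - N 0" "N 0"] by simp
        with lip[OF z, of 0] r N0 \<epsilon>U z show "norm (N z) \<le> r" by simp
      qed
    qed (use lip r in \<open>auto simp: dist_norm complete_eq_closed\<close>)
    then obtain z where z: "norm z \<le> r" "N z = z" by auto
    \<comment> \<open>Absorbing half of \<open>norm z\<close> on the left makes the fixed point
      linearly small in \<epsilon>, with constant \<open>2 * norm (U 0)\<close>.\<close>
    have "norm z \<le> 1/2 * norm z + \<bar>\<epsilon>\<bar> * norm (U 0)"
      using lip[OF z(1), of 0] z r N0 norm_triangle_ineq[of "N z - N 0" "N 0"] by simp
    then have nz: "norm z \<le> 2 * norm (U 0) * \<bar>\<epsilon>\<bar>" by (simp add: algebra_simps)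
    define q where "q = H' z - H z - \<epsilon> *\<^sub>R H' (T z)"
    have zq: "z = S q + \<epsilon> *\<^sub>R T z"
      using z(2) by (simp add: N_def U_def q_def S.add S.diff S.scaleR algebra_simps)
    from arg_cong[OF this, of H'] have "H' z = q + \<epsilon> *\<^sub>R H' (T z)"
      by (simp add: H'.add H'.scaleR S(2))
    then have "H z = 0" by (simp add: q_def)
    with nz zq show "\<exists>z q. norm z \<le> 2 * norm (U 0) * \<bar>\<epsilon>\<bar> \<and> H z = 0 \<and> z = S q + \<epsilon> *\<^sub>R T z"
      by blast
  qed
qed

section \<open>Matrices\<close>

text \<open>The type's \<open>norm\<close> on matrices is the Frobenius norm, and Cauchy-Schwarz is
  applied to each row. The hypotheses of the theorem use the operator norm, so both directions of
  the comparison are needed.\<close>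

lemma onorm_le_norm_matrix: "op_norm M \<le> norm M" for M :: "real^'n^'m"
proof (rule onorm_le)
  fix v :: "real^'n"
  have "norm (M *v v) \<le> L2_set (\<lambda>i. norm (M $ i) * norm v) UNIV"
    unfolding norm_vec_def[of "M *v v"]
    by (intro L2_set_mono) (auto simp: matrix_mult_dot Cauchy_Schwarz_ineq2)
  also have "\<dots> = norm M * norm v"
    by (simp add: norm_vec_def[of M] L2_set_left_distrib)
  finally show "norm (M *v v) \<le> norm M * norm v" .
qed

text \<open>Every entry is at most the operator norm, and the Frobenius norm is at most the sum of
  all absolute entries. The crude dimension factor only affects constants.\<close>

lemma norm_matrix_le_onorm:
  "norm M \<le> real CARD('m) * real CARD('n) * op_norm M" for M :: "real^'n^'m"
proof -
  have "norm M \<le> (\<Sum>i\<in>UNIV. norm (M $ i))"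
    unfolding norm_vec_def by (rule L2_set_le_sum) simp
  also have "\<dots> \<le> (\<Sum>i\<in>(UNIV::'m set). real CARD('n) * op_norm M)"
  proof (rule sum_mono)
    fix i
    have "norm (M $ i) \<le> (\<Sum>j\<in>UNIV. \<bar>M $ i $ j\<bar>)" by (rule norm_le_l1_cart)
    also have "\<dots> \<le> (\<Sum>j\<in>(UNIV::'n set). op_norm M)"
      by (intro sum_mono matrix_component_le_onorm)
    finally show "norm (M $ i) \<le> real CARD('n) * op_norm M" by simp
  qed
  finally show ?thesis by simp
qed

lemma norm_matrix_vector_mult_le: "norm (M *v v) \<le> op_norm M * norm v" for M :: "real^'n^'m"
  by (rule onorm) simp

lemma norm_matrix_vector_mult_le_norm: "norm (M *v v) \<le> norm M * norm v" for M :: "real^'n^'m"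
  by (meson norm_matrix_vector_mult_le onorm_le_norm_matrix mult_right_mono norm_ge_zero order.trans)

lemma bounded_bilinear_matrix_vector_mult:
  "bounded_bilinear ((*v) :: real^'n^'m \<Rightarrow> real^'n \<Rightarrow> real^'m)"
  by (rule bounded_bilinear.intro)
    (auto simp: matrix_vector_mult_add_rdistrib matrix_vector_right_distrib matrix_vector_mult_scaleR
      simp flip: scaleR_matrix_vector_assoc intro!: exI[of _ 1] norm_matrix_vector_mult_le_norm)

lemma bounded_bilinear_matrix_matrix_mult:
  "bounded_bilinear ((**) :: real^'n^'m \<Rightarrow> real^'k^'n \<Rightarrow> real^'k^'m)"
proof (rule bounded_bilinear.intro)
  show "\<exists>K. \<forall>(a::real^'n^'m) (b::real^'k^'n). norm (a ** b) \<le> norm a * norm b * K"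
  proof (intro exI allI)
    fix a :: "real^'n^'m" and b :: "real^'k^'n"
    have "op_norm (a ** b) \<le> norm a * norm b"
    proof (rule onorm_le)
      fix v :: "real^'k"
      have "norm (a *v (b *v v)) \<le> norm a * norm (b *v v)"
        by (rule norm_matrix_vector_mult_le_norm)
      also have "\<dots> \<le> norm a * (norm b * norm v)"
        by (intro mult_left_mono norm_matrix_vector_mult_le_norm) simp
      finally show "norm ((a ** b) *v v) \<le> norm a * norm b * norm v"
        by (simp add: matrix_vector_mul_assoc mult.assoc)
    qed
    then have "real CARD('m) * real CARD('k) * op_norm (a ** b)
        \<le> real CARD('m) * real CARD('k) * (norm a * norm b)"
      by (rule mult_left_mono) simp
    with norm_matrix_le_onorm[of "a ** b"]
    show "norm (a ** b) \<le> norm a * norm b * (real CARD('m) * real CARD('k))"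
      by (simp only: mult.commute[of "norm a * norm b"])
  qed
qed (auto simp: matrix_matrix_mult_def vec_eq_iff sum.distrib algebra_simps sum_distrib_left)

lemmas continuous_on_matrix_vector_mult [continuous_intros] =
  bounded_bilinear.continuous_on[OF bounded_bilinear_matrix_vector_mult]

lemmas continuous_on_matrix_matrix_mult [continuous_intros] =
  bounded_bilinear.continuous_on[OF bounded_bilinear_matrix_matrix_mult]

text \<open>The finite-dimensional Fredholm alternative. Split \<open>v = a + b\<close> with
  \<open>a\<close> in the range and \<open>b\<close> orthogonal to it. Then \<open>b\<close> lies in
  the kernel of the transpose, which the columns of \<open>W\<close> span, so \<open>v\<close> is
  orthogonal to \<open>b\<close>, and this forces \<open>b = 0\<close>.\<close>

lemma range_if_orthogonal_to_cokernel:
  fixes \<Lambda> :: "real^'n^'m" and W :: "real^'p^'m"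
  assumes W: "columns_basis_of W (mat_kernel (transpose \<Lambda>))" and v: "transpose W *v v = 0"
  shows "v \<in> range ((*v) \<Lambda>)"
proof -
  obtain a b where ab: "a \<in> span (range ((*v) \<Lambda>))"
    "\<And>w. w \<in> span (range ((*v) \<Lambda>)) \<Longrightarrow> orthogonal b w" "v = a + b"
    using orthogonal_subspace_decomp_exists[of "range ((*v) \<Lambda>)" v] by blast
  have span: "span (range ((*v) \<Lambda>)) = range ((*v) \<Lambda>)"
    by (simp add: span_eq_iff linear_subspace_image)
  have "transpose \<Lambda> *v b = 0"
  proof -
    have "(transpose \<Lambda> *v b) \<bullet> x = 0" for x
      using ab(2)[of "\<Lambda> *v x"] by (simp add: span dot_lmul_matrix orthogonal_def)
    then show ?thesis using inner_eq_zero_iff by blast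
  qed
  then have "b \<in> span (columns W)"
    using W by (simp add: columns_basis_of_def mat_kernel_def)
  moreover have "orthogonal v c" if c: "c \<in> columns W" for c
  proof -
    obtain j where "c = column j W" using c by (auto simp: columns_def)
    moreover have "(transpose W *v v) $ j = column j W \<bullet> v"
      by (simp add: matrix_vector_mult_def transpose_def column_def inner_vec_def)
    ultimately show ?thesis using v by (simp add: orthogonal_def inner_commute)
  qed
  ultimately have "orthogonal v b" by (rule orthogonal_to_span)
  moreover have "orthogonal b a" using ab by blast
  ultimately have "b = 0"
    using ab(3) by (simp add: orthogonal_def inner_add_left inner_add_right inner_commute)
  then show ?thesis using ab span by simp
qed

lemma matrix_mult_inv:
  fixes M :: "real^'n^'n"
  assumes "invertible M"
  shows "M ** matrix_inv M = mat 1" "matrix_inv M ** M = mat 1"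
  using someI_ex[OF assms[unfolded invertible_def]] unfolding matrix_inv_def by auto

section \<open>Partial Jacobians\<close>

text \<open>\<open>jacobian\<close> is meaningful only for a differentiable map. Joint
  differentiability supplies this by the chain rule along the embedding of \<open>v\<close> as
  \<open>(0, v)\<close>.\<close>

lemma has_derivative_jac_x:
  assumes "cont_differentiable f"
  shows "((\<lambda>z. f (t, z)) has_derivative (*v) (jac_x f t x)) (at x)"
proof -
  obtain F where F: "\<And>z. (f has_derivative blinfun_apply (F z)) (at z)"
    using assms unfolding cont_differentiable_def by blast
  have "((\<lambda>z. f (t, z)) has_derivative (\<lambda>v. F (t, x) (0, v))) (at x)"
    by (rule has_derivative_compose[OF _ F]) (auto intro!: derivative_eq_intros)
  then have "(\<lambda>z. f (t, z)) differentiable (at x)"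
    by (rule differentiableI)
  then show ?thesis
    unfolding jac_x_def jacobian_works .
qed

lemma continuous_on_cont_differentiable:
  assumes "cont_differentiable f"
  shows "continuous_on S f"
  using assms has_derivative_continuous continuous_at_imp_continuous_on
  unfolding cont_differentiable_def by blast

text \<open>The mean value inequality for \<open>f (t, z) - M *v z\<close> on a convex set. A
  Jacobian at a base point as \<open>M\<close> gives remainder estimates; \<open>M = 0\<close> gives
  plain Lipschitz estimates.\<close>

lemma jac_x_linearization:
  assumes f: "cont_differentiable f" and S: "convex S" "x \<in> S" "y \<in> S"
    and M: "\<And>z. z \<in> S \<Longrightarrow> op_norm (jac_x f t z - M) \<le> B"
  shows "norm (f (t, x) - f (t, y) - M *v (x - y)) \<le> B * norm (x - y)"
proof -
  have "norm ((f (t, x) - M *v x) - (f (t, y) - M *v y)) \<le> B * norm (x - y)"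
  proof (rule differentiable_bound[OF S(1) _ _ S(2,3), where f' = "\<lambda>z. (*v) (jac_x f t z - M)"])
    fix z
    show "((\<lambda>z. f (t, z) - M *v z) has_derivative (*v) (jac_x f t z - M)) (at z within S)"
      unfolding matrix_vector_mult_diff_rdistrib
      by (intro has_derivative_diff has_derivative_at_withinI[OF has_derivative_jac_x[OF f]]
          bounded_linear_imp_has_derivative matrix_vector_mul_bounded_linear)
  qed (rule M)
  then show ?thesis by (simp add: algebra_simps matrix_vector_mult_diff_distrib)
qed

text \<open>The set \<open>T\<close> need not be bounded, so the bound is propagated from \<open>0\<close> to \<open>x\<close> in steps of length
  less than a uniform modulus of continuity.\<close>

lemma bounded_on_cball_if_uniformly_continuous:
  fixes J :: "real \<Rightarrow> 'a::real_normed_vector \<Rightarrow> 'b::real_normed_vector"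
  assumes J: "uniformly_continuous_on (T \<times> cball 0 \<rho>) (\<lambda>(t, x). J t x)"
    and b: "\<And>t. t \<in> T \<Longrightarrow> norm (J t 0) \<le> b"
  obtains L where "\<And>t x. t \<in> T \<Longrightarrow> norm x \<le> \<rho> \<Longrightarrow> norm (J t x) \<le> L"
proof -
  obtain d where "d > 0" "\<forall>p\<in>T \<times> cball 0 \<rho>. \<forall>p'\<in>T \<times> cball 0 \<rho>. dist p' p < d \<longrightarrow>
      dist (case p' of (t, x) \<Rightarrow> J t x) (case p of (t, x) \<Rightarrow> J t x) < 1"
    using J zero_less_one unfolding uniformly_continuous_on_def by meson
  then have d: "d > 0" "\<And>t x t' x'. t \<in> T \<Longrightarrow> norm x \<le> \<rho> \<Longrightarrow> t' \<in> T \<Longrightarrow> norm x' \<le> \<rho> \<Longrightarrow>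
      dist (t', x') (t, x) < d \<Longrightarrow> dist (J t' x') (J t x) < 1"
    by fastforce+
  obtain N :: nat where N: "\<rho> / d < real N" using reals_Archimedean2 by blast
  have "norm (J t x) \<le> b + real (Suc N)" if t: "t \<in> T" and x: "norm x \<le> \<rho>" for t x
  proof -
    have \<rho>: "\<rho> \<ge> 0" using x norm_ge_zero order.trans by blast
    \<comment> \<open>The segment from 0 to \<open>x\<close> is cut into \<open>Suc N\<close>
      pieces. Each has length at most \<rho> / (N + 1), which is below \<open>d\<close> by the
      choice of \<open>N\<close>; each step costs at most 1.\<close>
    define c where "c k = (real k / real (Suc N)) *\<^sub>R x" for k
    have c: "norm (c k) \<le> \<rho>" if "k \<le> Suc N" for k
    proof -
      have "norm (c k) \<le> 1 * norm x"
        unfolding c_def norm_scaleR using that by (intro mult_right_mono) auto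
      with x show ?thesis by simp
    qed
    have "norm (J t (c k)) \<le> b + real k" if "k \<le> Suc N" for k
      using that
    proof (induction k)
      case 0
      then show ?case using b[OF t] by (simp add: c_def)
    next
      case (Suc k)
      have "c (Suc k) - c k = (1 / real (Suc N)) *\<^sub>R x"
        by (simp add: c_def algebra_simps add_divide_distrib flip: scaleR_left.diff)
      then have "dist (t, c (Suc k)) (t, c k) = norm x / real (Suc N)"
        by (simp add: dist_Pair_Pair dist_norm)
      also have "\<dots> < d"
        using N d(1) x by (simp add: field_simps)
      finally have "dist (J t (c (Suc k))) (J t (c k)) < 1"
        using d(2) t c Suc.prems by simp
      then show ?case
        using Suc norm_triangle_sub[of "J t (c (Suc k))" "J t (c k)"] by (simp add: dist_norm)
    qed
    from this[of "Suc N"] show ?thesis by (simp add: c_def)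
  qed
  then show ?thesis using that by blast
qed

section \<open>Bounded continuous functions on the half-line\<close>

text \<open>The type \<open>\<Rightarrow>\<^sub>C\<close> provides a complete space, but of functions on all of \<^typ>\<open>real\<close>; hence the
  constant extension to negative arguments. \<^const>\<open>Bcontfun\<close> is unspecified unless \<open>x\<close> lies
  in \<^const>\<open>bdd_cont\<close>.\<close>

definition bcontfun_of :: "(real \<Rightarrow> 'a::real_normed_vector) \<Rightarrow> real \<Rightarrow>\<^sub>C 'a" where
  "bcontfun_of x = Bcontfun (\<lambda>t. x (max 0 t))"

lemma apply_bcontfun_of:
  assumes "x \<in> bdd_cont"
  shows "apply_bcontfun (bcontfun_of x) t = x (max 0 t)"
proof -
  have "continuous_on UNIV (\<lambda>t. x (max 0 t))"
    by (rule continuous_on_compose2[of "{0..}" x])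
      (use assms in \<open>auto simp: bdd_cont_def intro!: continuous_intros\<close>)
  moreover have "bounded (range (\<lambda>t. x (max 0 t)))"
    by (rule bounded_subset[of "x ` {0..}"]) (use assms in \<open>auto simp: bdd_cont_def\<close>)
  ultimately show ?thesis
    unfolding bcontfun_of_def by (subst Bcontfun_inverse) (auto simp: bcontfun_def)
qed

lemma apply_bcontfun_in_bdd_cont: "apply_bcontfun z \<in> bdd_cont"
  using bounded_subset[OF bounded_apply_bcontfun[of z] image_mono[OF subset_UNIV]]
  by (simp add: bdd_cont_def)

lemma bdd_contI:
  assumes "continuous_on {0..} x" "\<And>t. t \<ge> 0 \<Longrightarrow> norm (x t) \<le> b"
  shows "x \<in> bdd_cont"
  using assms by (auto simp: bdd_cont_def intro!: boundedI[of _ b])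

lemma bdd_cont_bound:
  assumes "x \<in> bdd_cont"
  obtains b where "b > 0" "\<And>t. t \<ge> 0 \<Longrightarrow> norm (x t) \<le> b"
proof -
  obtain b where "b > 0" "\<forall>v\<in>x ` {0..}. norm v \<le> b"
    using assms unfolding bdd_cont_def bounded_pos by blast
  then show ?thesis by (intro that[of b]) auto
qed

lemma bdd_cont_continuous: "x \<in> bdd_cont \<Longrightarrow> continuous_on {0..} x"
  by (simp add: bdd_cont_def)

lemma bdd_cont_add: "x \<in> bdd_cont \<Longrightarrow> z \<in> bdd_cont \<Longrightarrow> (\<lambda>t. x t + z t) \<in> bdd_cont"
  using bounded_plus_comp[of x "{0..}" z] continuous_on_add[of "{0..}" x z]
  unfolding bdd_cont_def mem_Collect_eq by blast

lemma bdd_cont_diff: "x \<in> bdd_cont \<Longrightarrow> z \<in> bdd_cont \<Longrightarrow> (\<lambda>t. x t - z t) \<in> bdd_cont"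
  using bounded_minus_comp[of x "{0..}" z] continuous_on_diff[of "{0..}" x z]
  unfolding bdd_cont_def mem_Collect_eq by blast

lemma bdd_cont_scaleR: "x \<in> bdd_cont \<Longrightarrow> (\<lambda>t. c *\<^sub>R x t) \<in> bdd_cont"
  unfolding bdd_cont_def by (auto intro!: continuous_intros bounded_scaleR_comp)

lemma bdd_cont_cong:
  assumes "x \<in> bdd_cont" "\<And>t. t \<ge> 0 \<Longrightarrow> z t = x t"
  shows "z \<in> bdd_cont"
proof -
  have "z ` {0..} = x ` {0..}" using assms(2) by auto
  then show ?thesis
    using assms continuous_on_cong[of "{0..}" "{0..}" z x] by (simp add: bdd_cont_def)
qed

lemma norm_bcontfun_of_le:
  assumes "x \<in> bdd_cont" "\<And>t. t \<ge> 0 \<Longrightarrow> norm (x t) \<le> b"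
  shows "norm (bcontfun_of x) \<le> b"
  by (rule norm_bound) (simp add: apply_bcontfun_of assms)

lemma sup_norm_le: "(\<And>t. t \<ge> 0 \<Longrightarrow> norm (x t) \<le> b) \<Longrightarrow> sup_norm x \<le> b"
  unfolding sup_norm_def by (rule cSUP_least) auto

lemma sup_norm_nonneg:
  assumes "x \<in> bdd_cont"
  shows "sup_norm x \<ge> 0"
proof -
  have "bdd_above ((\<lambda>t. norm (x t)) ` {0..})"
    using bdd_cont_bound[OF assms] by (metis (no_types, lifting) atLeast_iff bdd_aboveI2)
  then have "norm (x 0) \<le> sup_norm x"
    unfolding sup_norm_def by (rule cSUP_upper[rotated]) simp
  then show ?thesis using norm_ge_zero order.trans by blast
qed

section \<open>Bounded linear maps on the functions over the half-line\<close>

context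
  fixes \<Gamma> :: "(real \<Rightarrow> 'a::real_normed_vector) \<Rightarrow> 'b::real_normed_vector"
  assumes \<Gamma>: "bounded_linear_on_bdd_cont \<Gamma>"
begin

lemma bounded_linear_on_bdd_cont_add:
  "x \<in> bdd_cont \<Longrightarrow> z \<in> bdd_cont \<Longrightarrow> \<Gamma> (\<lambda>t. x t + z t) = \<Gamma> x + \<Gamma> z"
  using \<Gamma> by (simp add: bounded_linear_on_bdd_cont_def)

lemma bounded_linear_on_bdd_cont_scaleR:
  "x \<in> bdd_cont \<Longrightarrow> \<Gamma> (\<lambda>t. c *\<^sub>R x t) = c *\<^sub>R \<Gamma> x"
  using \<Gamma> by (simp add: bounded_linear_on_bdd_cont_def)

text \<open>Pointwise bounds are easier to supply than \<open>sup_norm\<close>. The absolute value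
  of \<open>B\<close> makes the estimate monotone, as the sign of \<open>B\<close> is not
  prescribed.\<close>

lemma bounded_linear_on_bdd_cont_bound:
  "\<exists>B. \<forall>x\<in>bdd_cont. \<forall>b. (\<forall>t\<ge>0. norm (x t) \<le> b) \<longrightarrow> norm (\<Gamma> x) \<le> B * b"
proof -
  obtain B where B: "\<And>x. x \<in> bdd_cont \<Longrightarrow> norm (\<Gamma> x) \<le> B * sup_norm x"
    using \<Gamma> unfolding bounded_linear_on_bdd_cont_def by blast
  have "norm (\<Gamma> x) \<le> \<bar>B\<bar> * b"
    if x: "x \<in> bdd_cont" and b: "\<And>t. t \<ge> 0 \<Longrightarrow> norm (x t) \<le> b" for x b
  proof -
    have "norm (\<Gamma> x) \<le> \<bar>B\<bar> * sup_norm x"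
      using B[OF x] mult_right_mono[OF abs_ge_self sup_norm_nonneg[OF x], of B] by (rule order.trans)
    also have "\<dots> \<le> \<bar>B\<bar> * b"
      by (intro mult_left_mono sup_norm_le b) auto
    finally show ?thesis .
  qed
  then show ?thesis by blast
qed

text \<open>The difference \<open>z - x\<close> vanishes on the half-line, so its pointwise bound 0
  makes \<Gamma> send it to 0. This lets representatives with different values at negative arguments
  be exchanged.\<close>

lemma bounded_linear_on_bdd_cont_cong:
  assumes x: "x \<in> bdd_cont" and eq: "\<And>t. t \<ge> 0 \<Longrightarrow> z t = x t"
  shows "\<Gamma> z = \<Gamma> x"
proof -
  have z: "z \<in> bdd_cont" using bdd_cont_cong[OF x eq] .
  obtain B where B: "\<forall>x\<in>bdd_cont. \<forall>b. (\<forall>t\<ge>0. norm (x t) \<le> b) \<longrightarrow> norm (\<Gamma> x) \<le> B * b"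
    using bounded_linear_on_bdd_cont_bound by blast
  have "norm (\<Gamma> (\<lambda>t. z t - x t)) \<le> B * 0"
    using eq by (intro B[rule_format] bdd_cont_diff x z) simp
  then have "\<Gamma> (\<lambda>t. z t - x t) = 0" by simp
  moreover have "\<Gamma> (\<lambda>t. x t + (z t - x t)) = \<Gamma> x + \<Gamma> (\<lambda>t. z t - x t)"
    by (intro bounded_linear_on_bdd_cont_add bdd_cont_diff x z)
  ultimately show ?thesis by simp
qed

lemma bounded_linear_on_bcontfun: "bounded_linear (\<lambda>z. \<Gamma> (apply_bcontfun z))"
proof -
  obtain B where B: "\<forall>x\<in>bdd_cont. \<forall>b. (\<forall>t\<ge>0. norm (x t) \<le> b) \<longrightarrow> norm (\<Gamma> x) \<le> B * b"
    using bounded_linear_on_bdd_cont_bound by blast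
  show ?thesis
  proof (rule bounded_linear_intro)
    fix z w :: "real \<Rightarrow>\<^sub>C 'a" and c
    show "\<Gamma> (apply_bcontfun (z + w)) = \<Gamma> (apply_bcontfun z) + \<Gamma> (apply_bcontfun w)"
      using bounded_linear_on_bdd_cont_add[OF apply_bcontfun_in_bdd_cont[of z]
          apply_bcontfun_in_bdd_cont[of w]]
      by (simp add: plus_bcontfun.rep_eq[abs_def])
    show "\<Gamma> (apply_bcontfun (c *\<^sub>R z)) = c *\<^sub>R \<Gamma> (apply_bcontfun z)"
      using bounded_linear_on_bdd_cont_scaleR[OF apply_bcontfun_in_bdd_cont[of z]]
      by (simp add: scaleR_bcontfun.rep_eq[abs_def])
    show "norm (\<Gamma> (apply_bcontfun z)) \<le> norm z * B"
      using B[rule_format, OF apply_bcontfun_in_bdd_cont norm_bounded[of z]]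
      by (simp add: mult.commute)
  qed
qed

lemma bounded_linear_on_bdd_cont_bcontfun_of:
  "x \<in> bdd_cont \<Longrightarrow> \<Gamma> (apply_bcontfun (bcontfun_of x)) = \<Gamma> x"
  by (rule bounded_linear_on_bdd_cont_cong) (auto simp: apply_bcontfun_of)

end

text \<open>The map sending \<open>w\<close> to \<open>\<Gamma> (\<lambda>t. M t *v w)\<close> is
  linear, and its values on the standard basis are the columns of
  \<open>columnwise \<Gamma> M\<close>.\<close>

lemma columnwise_mult:
  fixes \<Gamma> :: "(real \<Rightarrow> real^'n) \<Rightarrow> real^'m" and M :: "real \<Rightarrow> real^'k^'n"
  assumes \<Gamma>: "bounded_linear_on_bdd_cont \<Gamma>" and M: "\<And>w. (\<lambda>t. M t *v w) \<in> bdd_cont"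
  shows "columnwise \<Gamma> M *v w = \<Gamma> (\<lambda>t. M t *v w)"
proof -
  have "linear (\<lambda>w. \<Gamma> (\<lambda>t. M t *v w))"
    by (rule linearI)
      (simp_all add: matrix_vector_right_distrib matrix_vector_mult_scaleR M
        bounded_linear_on_bdd_cont_add[OF \<Gamma>] bounded_linear_on_bdd_cont_scaleR[OF \<Gamma>])
  from fun_cong[OF matrix_vector_mul(2)[OF this], of w] show ?thesis
    by (simp add: columnwise_def matrix_def matrix_vector_mult_basis)
qed

section \<open>Exponentially stable linear systems\<close>

locale stable_system =
  fixes A \<Phi> :: "real \<Rightarrow> real^'n^'n" and K \<alpha> :: real
  assumes cont_A: "continuous_on {0..} A"
    and fundamental: "fundamental_matrix A \<Phi>"
    and K_pos: "K > 0" and \<alpha>_pos: "\<alpha> > 0"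
    and decay: "\<And>t s. t \<ge> s \<Longrightarrow> s \<ge> 0 \<Longrightarrow>
      op_norm (\<Phi> t ** matrix_inv (\<Phi> s)) \<le> K * exp (- \<alpha> * (t - s))"
begin

lemma has_vector_derivative_fundamental:
  "t \<ge> 0 \<Longrightarrow> (\<Phi> has_vector_derivative (A t ** \<Phi> t)) (at t within {0..})"
  using fundamental by (simp add: fundamental_matrix_def)

lemma continuous_on_fundamental: "continuous_on {0..} \<Phi>"
  unfolding continuous_on_eq_continuous_within
  using has_vector_derivative_continuous[OF has_vector_derivative_fundamental] by simp

lemma has_vector_derivative_fundamental_mult:
  "t \<ge> 0 \<Longrightarrow>
    ((\<lambda>t. \<Phi> t *v v) has_vector_derivative (A t *v (\<Phi> t *v v))) (at t within {0..})"
  using bounded_linear.has_vector_derivative[OF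
      bounded_bilinear.bounded_linear_left[OF bounded_bilinear_matrix_vector_mult]
      has_vector_derivative_fundamental, of t v]
  by (simp add: matrix_vector_mul_assoc)

text \<open>A backward Gronwall estimate: if \<open>L\<close> bounds \<open>A\<close> on \<open>[0, T]\<close>, then
  \<open>exp (2 L t) |\<Phi> t v|\<^sup>2\<close> is nondecreasing there.\<close>

lemma invertible_fundamental:
  assumes T: "T \<ge> 0"
  shows "invertible (\<Phi> T)"
proof -
  have "v = 0" if v: "\<Phi> T *v v = 0" for v
  proof -
    define x where "x t = \<Phi> t *v v" for t
    have "compact (A ` {0..T})"
      by (intro compact_continuous_image continuous_on_subset[OF cont_A]) auto
    then obtain L where L: "\<forall>M\<in>A ` {0..T}. norm M \<le> L"
      using compact_imp_bounded[of "A ` {0..T}"] unfolding bounded_iff by metis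
    have "exp (2 * L * 0) * (x 0 \<bullet> x 0) \<le> exp (2 * L * T) * (x T \<bullet> x T)"
    proof (rule DERIV_nonneg_imp_increasing_open[OF T])
      fix t assume t: "0 < t" "t < T"
      have "at t within {0..} = at t"
        using t by (intro at_within_interior) (simp add: interior_Ici)
      then have "(x has_vector_derivative (A t *v x t)) (at t)"
        using has_vector_derivative_fundamental_mult[of t v] t unfolding x_def by simp
      then have "((\<lambda>t. x t \<bullet> x t) has_real_derivative 2 * (x t \<bullet> (A t *v x t))) (at t)"
        using bounded_bilinear.has_vector_derivative[OF bounded_bilinear_inner, of x _ t UNIV x]
        by (fastforce simp: has_real_derivative_iff_has_vector_derivative inner_commute)
      then have "((\<lambda>t. exp (2 * L * t) * (x t \<bullet> x t)) has_real_derivative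
          exp (2 * L * t) * (2 * (L * (x t \<bullet> x t) + x t \<bullet> (A t *v x t)))) (at t)"
        by (auto intro!: derivative_eq_intros simp: algebra_simps)
      moreover have "\<bar>x t \<bullet> (A t *v x t)\<bar> \<le> L * (x t \<bullet> x t)"
      proof -
        have "\<bar>x t \<bullet> (A t *v x t)\<bar> \<le> norm (x t) * norm (A t *v x t)"
          by (rule Cauchy_Schwarz_ineq2)
        also have "\<dots> \<le> norm (x t) * (norm (A t) * norm (x t))"
          by (intro mult_left_mono norm_matrix_vector_mult_le_norm) auto
        also have "\<dots> \<le> norm (x t) * (L * norm (x t))"
          using t L by (intro mult_left_mono mult_right_mono) auto
        also have "\<dots> = L * (x t \<bullet> x t)"
          by (simp add: dot_square_norm power2_eq_square)
        finally show ?thesis .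
      qed
      ultimately show "\<exists>y. ((\<lambda>t. exp (2 * L * t) * (x t \<bullet> x t)) has_real_derivative y) (at t) \<and> 0 \<le> y"
        by (intro exI conjI) (assumption, auto intro!: mult_nonneg_nonneg)
    next
      show "continuous_on {0..T} (\<lambda>t. exp (2 * L * t) * (x t \<bullet> x t))"
        unfolding x_def
        by (intro continuous_intros continuous_on_subset[OF continuous_on_fundamental]) auto
    qed
    moreover have "x T = 0" "x 0 = v"
      using v fundamental by (simp_all add: x_def fundamental_matrix_def)
    ultimately have "v \<bullet> v \<le> 0" by simp
    then show "v = 0" by (meson inner_gt_zero_iff not_le)
  qed
  then show ?thesis
    unfolding invertible_left_inverse matrix_left_invertible_ker by blast
qed

text \<open>The decay estimate at \<open>s = 0\<close>, where the inverse is the identity.\<close>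

lemma norm_fundamental_mult_le:
  assumes "t \<ge> 0"
  shows "norm (\<Phi> t *v v) \<le> K * norm v"
proof -
  have "\<Phi> 0 = mat 1" using fundamental by (simp add: fundamental_matrix_def)
  then have "matrix_inv (\<Phi> 0) = mat 1"
    using matrix_mult_inv(1)[of "\<Phi> 0"] invertible_fundamental[of 0] by simp
  then have "op_norm (\<Phi> t) \<le> K * exp (- \<alpha> * t)"
    using decay[of 0 t] assms by simp
  also have "\<dots> \<le> K * 1"
    using K_pos \<alpha>_pos assms by (intro mult_left_mono) auto
  finally have "op_norm (\<Phi> t) * norm v \<le> K * norm v" by (intro mult_right_mono) auto
  with norm_matrix_vector_mult_le show ?thesis by (rule order.trans)
qed

lemma fundamental_mult_in_bdd_cont: "(\<lambda>t. \<Phi> t *v v) \<in> bdd_cont"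
  by (intro bdd_contI[of _ "K * norm v"] norm_fundamental_mult_le continuous_intros
      continuous_on_fundamental)

text \<open>With \<Psi> the inverse of \<Phi>, continuity follows from \<Psi>(s) - \<Psi>(t) =
  \<Psi>(s) (\<Phi>(t) - \<Phi>(s)) \<Psi>(t) once \<Psi> is locally bounded. Local boundedness
  comes from \<Psi>(s) = \<Psi>(t+1) (\<Phi>(t+1) \<Psi>(s)), whose second factor the decay estimate
  controls.\<close>

lemma continuous_on_fundamental_inv: "continuous_on {0..} (\<lambda>s. matrix_inv (\<Phi> s))"
  unfolding continuous_on_def
proof (intro ballI)
  fix t :: real assume "t \<in> {0..}"
  then have t: "t \<ge> 0" by simp
  let ?\<Psi> = "\<lambda>s. matrix_inv (\<Phi> s)"
  obtain c where c: "c > 0"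
    "\<And>a b. norm ((a :: real^'n^'n) ** (b :: real^'n^'n)) \<le> norm a * norm b * c"
    using bounded_bilinear.pos_bounded[OF bounded_bilinear_matrix_matrix_mult] by blast
  \<comment> \<open>Anchoring at \<open>t + 1\<close> rather than \<open>t\<close> makes the bound
    valid on both sides of \<open>t\<close>.\<close>
  define B where "B = norm (?\<Psi> (t + 1)) * (real CARD('n) * real CARD('n) * K) * c"
  have B: "norm (?\<Psi> s) \<le> B" if "0 \<le> s" "s \<le> t + 1" for s
  proof -
    have "?\<Psi> s = ?\<Psi> (t + 1) ** (\<Phi> (t + 1) ** ?\<Psi> s)"
      using t by (simp add: matrix_mul_assoc matrix_mult_inv invertible_fundamental)
    then have "norm (?\<Psi> s) \<le> norm (?\<Psi> (t + 1)) * norm (\<Phi> (t + 1) ** ?\<Psi> s) * c"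
      using c(2) by metis
    also have "norm (\<Phi> (t + 1) ** ?\<Psi> s) \<le> real CARD('n) * real CARD('n) * K"
    proof -
      have "op_norm (\<Phi> (t + 1) ** ?\<Psi> s) \<le> K * exp (- \<alpha> * (t + 1 - s))"
        using decay that by simp
      also have "\<dots> \<le> K * 1"
        using K_pos \<alpha>_pos that by (intro mult_left_mono) auto
      finally have "real CARD('n) * real CARD('n) * op_norm (\<Phi> (t + 1) ** ?\<Psi> s)
          \<le> real CARD('n) * real CARD('n) * K"
        by (intro mult_left_mono) auto
      with norm_matrix_le_onorm show ?thesis by (rule order.trans)
    qed
    finally show ?thesis
      using c(1) by (simp add: B_def mult_left_mono mult_right_mono)
  qed
  have B0: "B \<ge> 0" using B[of t] t order.trans[OF norm_ge_zero] by simp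
  have "((\<lambda>s. ?\<Psi> s - ?\<Psi> t) \<longlongrightarrow> 0) (at t within {0..})"
  proof (rule Lim_null_comparison)
    have "\<forall>\<^sub>F s in at t within {0..}. s < t + 1"
      by (intro order_tendstoD(2)[OF tendsto_ident_at]) simp
    moreover have "\<forall>\<^sub>F s in at t within {0..}. s \<in> {0..}"
      by (simp add: eventually_at_filter)
    ultimately
    show "\<forall>\<^sub>F s in at t within {0..}. norm (?\<Psi> s - ?\<Psi> t) \<le> B * norm (\<Phi> t - \<Phi> s) * c * B * c"
    proof eventually_elim
      case (elim s)
      have "(?\<Psi> s ** (\<Phi> t - \<Phi> s)) ** ?\<Psi> t = ?\<Psi> s ** (\<Phi> t ** ?\<Psi> t) - (?\<Psi> s ** \<Phi> s) ** ?\<Psi> t"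
        by (simp add: matrix_mul_assoc bounded_bilinear.diff_left[OF bounded_bilinear_matrix_matrix_mult]
            bounded_bilinear.diff_right[OF bounded_bilinear_matrix_matrix_mult])
      also have "\<dots> = ?\<Psi> s - ?\<Psi> t"
        using elim t by (simp add: matrix_mult_inv invertible_fundamental)
      finally have "norm (?\<Psi> s - ?\<Psi> t) \<le> norm (?\<Psi> s ** (\<Phi> t - \<Phi> s)) * norm (?\<Psi> t) * c"
        using c(2) by metis
      also have "\<dots> \<le> (norm (?\<Psi> s) * norm (\<Phi> t - \<Phi> s) * c) * norm (?\<Psi> t) * c"
        using c by (intro mult_right_mono) auto
      also have "\<dots> \<le> (B * norm (\<Phi> t - \<Phi> s) * c) * B * c"
        using c(1) B elim t B0 by (intro mult_mono) auto
      finally show ?case .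
    qed
    have "(\<Phi> \<longlongrightarrow> \<Phi> t) (at t within {0..})"
      using continuous_on_fundamental t by (simp add: continuous_on_def)
    then have "((\<lambda>s. norm (\<Phi> t - \<Phi> s)) \<longlongrightarrow> norm (\<Phi> t - \<Phi> t)) (at t within {0..})"
      by (rule tendsto_norm[OF tendsto_diff[OF tendsto_const]])
    then have "((\<lambda>s. B * norm (\<Phi> t - \<Phi> s) * c * B * c) \<longlongrightarrow> B * norm (\<Phi> t - \<Phi> t) * c * B * c)
        (at t within {0..})"
      by (intro tendsto_mult_right tendsto_mult_left)
    then show "((\<lambda>s. B * norm (\<Phi> t - \<Phi> s) * c * B * c) \<longlongrightarrow> 0) (at t within {0..})"
      by simp
  qed
  then show "(?\<Psi> \<longlongrightarrow> ?\<Psi> t) (at t within {0..})"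
    by (simp add: LIM_zero_iff)
qed

section \<open>Variation of constants\<close>

lemma duhamel_integrable:
  assumes "continuous_on {0..} k"
  shows "(\<lambda>s. matrix_inv (\<Phi> s) *v k s) integrable_on {0..t}"
  by (intro integrable_continuous_real continuous_intros continuous_on_subset[OF assms]
      continuous_on_subset[OF continuous_on_fundamental_inv]) auto

lemma solves_duhamel:
  assumes k: "continuous_on {0..} k"
  shows "solves_lin_ode A k (duhamel \<Phi> k)"
  unfolding solves_lin_ode_def
proof (intro allI impI)
  fix t :: real assume t: "t \<ge> 0"
  let ?I = "\<lambda>t. integral {0..t} (\<lambda>s. matrix_inv (\<Phi> s) *v k s)"
  \<comment> \<open>The fundamental theorem needs a compact interval. Ending it at
    \<open>t + 1\<close> keeps a right neighbourhood of \<open>t\<close>, so the filter agrees with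
    that of the half-line.\<close>
  have "continuous_on {0..t+1} (\<lambda>s. matrix_inv (\<Phi> s) *v k s)"
    by (intro continuous_intros continuous_on_subset[OF k]
        continuous_on_subset[OF continuous_on_fundamental_inv]) auto
  then have "(?I has_vector_derivative matrix_inv (\<Phi> t) *v k t) (at t within {0..t+1})"
    by (rule integral_has_vector_derivative) (use t in auto)
  moreover have "at t within {0..t+1} = at t within {0..}"
    using t by (intro at_within_nhd[of t "{..<t+1}"]) auto
  ultimately have "(?I has_vector_derivative matrix_inv (\<Phi> t) *v k t) (at t within {0..})" by simp
  from bounded_bilinear.has_vector_derivative[OF bounded_bilinear_matrix_vector_mult
      has_vector_derivative_fundamental[OF t] this]
  show "(duhamel \<Phi> k has_vector_derivative A t *v duhamel \<Phi> k t + k t) (at t within {0..})"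
    using t by (simp add: duhamel_def[abs_def] matrix_vector_mul_assoc matrix_mult_inv
        invertible_fundamental add.commute)
qed

lemma continuous_on_duhamel:
  assumes "continuous_on {0..} k"
  shows "continuous_on {0..} (duhamel \<Phi> k)"
  using solves_duhamel[OF assms]
  unfolding solves_lin_ode_def continuous_on_eq_continuous_within
  by (auto intro: has_vector_derivative_continuous)

text \<open>The kernel is at most K exp(-\<alpha>(t-s)), whose integral over [0, t] is at most
  K/\<alpha>. Hence \<open>duhamel\<close> is bounded on the half-line uniformly in
  \<open>t\<close>, the quantitative core of every estimate for the \<open>f\<close> term.\<close>

lemma norm_duhamel_le:
  assumes k: "continuous_on {0..} k" and B: "\<And>s. s \<ge> 0 \<Longrightarrow> norm (k s) \<le> B" and t: "t \<ge> 0"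
  shows "norm (duhamel \<Phi> k t) \<le> K / \<alpha> * B"
proof -
  have B0: "B \<ge> 0" using B[of 0] norm_ge_zero order.trans by blast
  let ?k = "\<lambda>s. matrix_inv (\<Phi> s) *v k s"
  have "duhamel \<Phi> k t = integral {0..t} (\<lambda>s. \<Phi> t *v ?k s)"
    unfolding duhamel_def
    using integral_linear[OF duhamel_integrable[OF k, of t]
          matrix_vector_mul_bounded_linear[of "\<Phi> t"]]
    by (simp add: o_def)
  also have "norm \<dots> \<le> integral {0..t} (\<lambda>s. K * exp (- \<alpha> * (t - s)) * B)"
  proof (rule integral_norm_bound_integral)
    show "(\<lambda>s. \<Phi> t *v ?k s) integrable_on {0..t}"
      using integrable_linear[OF duhamel_integrable[OF k, of t]
          matrix_vector_mul_bounded_linear[of "\<Phi> t"]]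
      by (simp add: o_def)
    show "(\<lambda>s. K * exp (- \<alpha> * (t - s)) * B) integrable_on {0..t}"
      by (intro integrable_continuous_real continuous_intros)
    fix s assume "s \<in> {0..t}"
    then have s: "0 \<le> s" "s \<le> t" by auto
    have "norm (\<Phi> t *v ?k s) \<le> op_norm (\<Phi> t ** matrix_inv (\<Phi> s)) * norm (k s)"
      unfolding matrix_vector_mul_assoc by (rule norm_matrix_vector_mult_le)
    also have "\<dots> \<le> K * exp (- \<alpha> * (t - s)) * B"
      using s K_pos by (intro mult_mono decay B) auto
    finally show "norm (\<Phi> t *v ?k s) \<le> K * exp (- \<alpha> * (t - s)) * B" .
  qed
  also have "\<dots> = K / \<alpha> * B * exp (- \<alpha> * (t - t)) - K / \<alpha> * B * exp (- \<alpha> * (t - 0))"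
  proof (rule integral_unique, rule fundamental_theorem_of_calculus[OF t])
    fix s
    show "((\<lambda>s. K / \<alpha> * B * exp (- \<alpha> * (t - s))) has_vector_derivative
        K * exp (- \<alpha> * (t - s)) * B) (at s within {0..t})"
      unfolding has_real_derivative_iff_has_vector_derivative[symmetric]
      using \<alpha>_pos by (auto intro!: derivative_eq_intros simp: field_simps)
  qed
  also have "\<dots> \<le> K / \<alpha> * B"
    using K_pos \<alpha>_pos B0 by simp
  finally show ?thesis .
qed

lemma duhamel_in_bdd_cont:
  assumes "k \<in> bdd_cont"
  shows "duhamel \<Phi> k \<in> bdd_cont"
proof -
  obtain b where "\<And>t. t \<ge> 0 \<Longrightarrow> norm (k t) \<le> b" using bdd_cont_bound[OF assms] by blast
  then show ?thesis
    using bdd_cont_continuous[OF assms]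
    by (intro bdd_contI[OF continuous_on_duhamel norm_duhamel_le])
qed

lemma duhamel_add:
  assumes "continuous_on {0..} k" "continuous_on {0..} l"
  shows "duhamel \<Phi> (\<lambda>s. k s + l s) t = duhamel \<Phi> k t + duhamel \<Phi> l t"
  unfolding duhamel_def matrix_vector_right_distrib
  by (subst integral_add) (auto intro: duhamel_integrable assms simp: matrix_vector_right_distrib)

lemma duhamel_scaleR: "duhamel \<Phi> (\<lambda>s. c *\<^sub>R k s) t = c *\<^sub>R duhamel \<Phi> k t"
  by (simp add: duhamel_def matrix_vector_mult_scaleR)

lemma duhamel_diff:
  assumes "continuous_on {0..} k" "continuous_on {0..} l"
  shows "duhamel \<Phi> (\<lambda>s. k s - l s) t = duhamel \<Phi> k t - duhamel \<Phi> l t"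
  using duhamel_add[OF assms(1) continuous_on_minus[OF assms(2)]] duhamel_scaleR[of "-1" l] by simp

lemma duhamel_mat_mult:
  fixes M :: "real \<Rightarrow> real^'k^'n"
  assumes "continuous_on {0..} M"
  shows "duhamel_mat \<Phi> M t *v w = duhamel \<Phi> (\<lambda>s. M s *v w) t"
proof -
  have "(\<lambda>s. matrix_inv (\<Phi> s) ** M s) integrable_on {0..t}"
    by (intro integrable_continuous_real continuous_intros continuous_on_subset[OF assms]
        continuous_on_subset[OF continuous_on_fundamental_inv]) auto
  from integral_linear[OF this bounded_bilinear.bounded_linear_left[OF
        bounded_bilinear_matrix_vector_mult], of w]
  show ?thesis
    unfolding duhamel_mat_def duhamel_def
    by (simp add: o_def matrix_vector_mul_assoc[symmetric])
qed

lemma fundamental_in_bdd_cont: "\<Phi> \<in> bdd_cont"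
proof (rule bdd_contI[OF continuous_on_fundamental])
  fix t :: real assume t: "t \<ge> 0"
  have "op_norm (\<Phi> t) \<le> K"
    by (rule onorm_le) (rule norm_fundamental_mult_le[OF t])
  then have "real CARD('n) * real CARD('n) * op_norm (\<Phi> t) \<le> real CARD('n) * real CARD('n) * K"
    by (intro mult_left_mono) auto
  with norm_matrix_le_onorm show "norm (\<Phi> t) \<le> real CARD('n) * real CARD('n) * K"
    by (rule order.trans)
qed

end

section \<open>Strict derivatives of the nonlinear terms\<close>

lemma continuous_on_jac_x_along:
  assumes uc: "\<And>S. compact S \<Longrightarrow> uniformly_continuous_on ({0..} \<times> S) (\<lambda>(t, x). jac_x f t x)"
    and x: "x \<in> bdd_cont"
  shows "continuous_on {0..} (\<lambda>t. jac_x f t (x t))"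
proof -
  obtain b where b: "\<And>t. t \<ge> 0 \<Longrightarrow> norm (x t) \<le> b" using bdd_cont_bound[OF x] by blast
  have "continuous_on ({0..} \<times> cball 0 b) (\<lambda>(t, x). jac_x f t x)"
    by (intro uniformly_continuous_imp_continuous uc compact_cball)
  then have "continuous_on {0..} (\<lambda>t. (\<lambda>(t, x). jac_x f t x) (t, x t))"
    by (rule continuous_on_compose2)
      (use b in \<open>auto intro!: continuous_intros bdd_cont_continuous[OF x]\<close>)
  then show ?thesis by simp
qed

lemma continuous_on_along:
  assumes f: "cont_differentiable f" and x: "x \<in> bdd_cont" and z: "z \<in> bdd_cont"
  shows "continuous_on {0..} (\<lambda>t. f (t, x t + z t))"
  by (rule continuous_on_compose2[OF continuous_on_cont_differentiable[OF f, of UNIV]])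
    (use x z in \<open>auto intro!: continuous_intros simp: bdd_cont_def\<close>)

text \<open>Uniform continuity in both variables gives one radius for all \<open>t\<close> on which
  the Jacobian varies by at most \<open>e\<close> around \<open>x t\<close>. The mean value
  inequality then bounds the remainder.\<close>

lemma jac_x_strict_estimate:
  assumes f: "cont_differentiable f"
    and uc: "\<And>S. compact S \<Longrightarrow> uniformly_continuous_on ({0..} \<times> S) (\<lambda>(t, x). jac_x f t x)"
    and x: "x \<in> bdd_cont" and e: "e > 0"
  obtains r where "r > 0" "\<And>t v w. t \<ge> 0 \<Longrightarrow> norm v \<le> r \<Longrightarrow> norm w \<le> r \<Longrightarrow>
    norm (f (t, x t + v) - f (t, x t + w) - jac_x f t (x t) *v (v - w)) \<le> e * norm (v - w)"
proof -
  obtain b where b: "b > 0" "\<And>t. t \<ge> 0 \<Longrightarrow> norm (x t) \<le> b" using bdd_cont_bound[OF x] by blast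
  obtain d where d: "d > 0" "\<forall>p\<in>{0..} \<times> cball 0 (b + 1). \<forall>p'\<in>{0..} \<times> cball 0 (b + 1).
      dist p' p < d \<longrightarrow> dist (case p' of (t, x) \<Rightarrow> jac_x f t x) (case p of (t, x) \<Rightarrow> jac_x f t x) < e"
    using uc[OF compact_cball, of 0 "b + 1"] e unfolding uniformly_continuous_on_def by meson
  \<comment> \<open>The cap 1 keeps the ball around \<open>x t\<close> inside the ball of radius
    \<open>b + 1\<close>; \<open>d / 2\<close> makes distances strictly less than
    \<open>d\<close>.\<close>
  define r where "r = min 1 (d / 2)"
  have r: "r > 0" "r \<le> 1" "r < d" using d(1) by (auto simp: r_def)
  have "norm (f (t, x t + v) - f (t, x t + w) - jac_x f t (x t) *v (v - w)) \<le> e * norm (v - w)"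
    if t: "t \<ge> 0" and vw: "norm v \<le> r" "norm w \<le> r" for t v w
  proof -
    have "norm (f (t, x t + v) - f (t, x t + w) - jac_x f t (x t) *v (x t + v - (x t + w)))
        \<le> e * norm (x t + v - (x t + w))"
    proof (rule jac_x_linearization[OF f convex_cball[of "x t" r]])
      fix z assume z: "z \<in> cball (x t) r"
      then have zr: "norm (z - x t) \<le> r" by (simp add: dist_norm norm_minus_commute)
      then have "norm z \<le> b + 1"
        using b(2)[OF t] r(2) norm_triangle_sub[of z "x t"] by linarith
      moreover have "dist (t, z) (t, x t) < d"
        using zr r(3) by (simp add: dist_Pair_Pair dist_norm)
      ultimately have "dist (jac_x f t z) (jac_x f t (x t)) < e"
        using d(2)[rule_format, of "(t, x t)" "(t, z)"] b(2)[OF t] t by simp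
      then show "op_norm (jac_x f t z - jac_x f t (x t)) \<le> e"
        using onorm_le_norm_matrix[of "jac_x f t z - jac_x f t (x t)"] by (simp add: dist_norm)
    qed (use vw in \<open>auto simp: dist_norm\<close>)
    then show ?thesis by simp
  qed
  with r(1) show ?thesis by (rule that)
qed

lemma jac_x_bounded:
  fixes f :: "real \<times> (real^'n) \<Rightarrow> real^'m"
  assumes uc: "\<And>S. compact S \<Longrightarrow> uniformly_continuous_on ({0..} \<times> S) (\<lambda>(t, x). jac_x f t x)"
    and jac_0: "bdd_above ((\<lambda>t. op_norm (jac_x f t 0)) ` {0..})"
  obtains L where "\<And>t z. t \<ge> 0 \<Longrightarrow> norm z \<le> \<rho> \<Longrightarrow> norm (jac_x f t z) \<le> L"
proof -
  obtain b where b: "\<And>t. t \<ge> 0 \<Longrightarrow> op_norm (jac_x f t 0) \<le> b"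
    using jac_0 unfolding bdd_above_def by auto
  have "norm (jac_x f t 0) \<le> real CARD('m) * real CARD('n) * b" if "t \<in> {0..}" for t
    by (rule order.trans[OF norm_matrix_le_onorm]) (use b that in \<open>auto intro!: mult_left_mono\<close>)
  from bounded_on_cball_if_uniformly_continuous[OF uc[OF compact_cball] this, of \<rho>]
  show ?thesis using that by (metis atLeast_iff)
qed

context
  fixes f :: "real \<times> (real^'n) \<Rightarrow> real^'m" and x :: "real \<Rightarrow> real^'n"
  assumes uc: "\<And>S. compact S \<Longrightarrow> uniformly_continuous_on ({0..} \<times> S) (\<lambda>(t, x). jac_x f t x)"
    and jac_0: "bdd_above ((\<lambda>t. op_norm (jac_x f t 0)) ` {0..})"
    and x: "x \<in> bdd_cont"
begin

lemma jac_x_mult_bounded: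
  obtains L where "L \<ge> 0"
    "\<forall>z\<in>bdd_cont. \<forall>b. (\<forall>t\<ge>0. norm (z t) \<le> b) \<longrightarrow> (\<forall>t\<ge>0. norm (jac_x f t (x t) *v z t) \<le> L * b)"
proof -
  obtain b where b: "\<And>t. t \<ge> 0 \<Longrightarrow> norm (x t) \<le> b" using bdd_cont_bound[OF x] by blast
  obtain L where L: "\<And>t z. t \<ge> 0 \<Longrightarrow> norm z \<le> b \<Longrightarrow> norm (jac_x f t z) \<le> L"
    using jac_x_bounded[OF uc jac_0, of b] by blast
  have L0: "L \<ge> 0" using L[of 0 "x 0"] b[of 0] order.trans[OF norm_ge_zero] by simp
  have "norm (jac_x f t (x t) *v z t) \<le> L * c" if "\<forall>t\<ge>0. norm (z t) \<le> c" "t \<ge> 0" for z :: "real \<Rightarrow> real^'n" and c t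
    by (rule order.trans[OF norm_matrix_vector_mult_le_norm])
      (use that L b L0 in \<open>auto intro!: mult_mono\<close>)
  with L0 show ?thesis by (intro that[of L]) auto
qed

lemma jac_x_mult_in_bdd_cont:
  assumes z: "z \<in> bdd_cont"
  shows "(\<lambda>t. jac_x f t (x t) *v z t) \<in> bdd_cont"
proof -
  obtain b where "\<And>t. t \<ge> 0 \<Longrightarrow> norm (z t) \<le> b" using bdd_cont_bound[OF z] by blast
  then have b: "\<forall>t\<ge>0. norm (z t) \<le> b" by blast
  obtain L where L: "L \<ge> 0" "\<forall>z\<in>bdd_cont. \<forall>b. (\<forall>t\<ge>0. norm (z t) \<le> b) \<longrightarrow>
      (\<forall>t\<ge>0. norm (jac_x f t (x t) *v z t) \<le> L * b)"
    using jac_x_mult_bounded by blast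
  show ?thesis
  proof (rule bdd_contI)
    show "continuous_on {0..} (\<lambda>t. jac_x f t (x t) *v z t)"
      by (rule continuous_on_matrix_vector_mult[OF continuous_on_jac_x_along[OF uc x]
            bdd_cont_continuous[OF z]])
    show "norm (jac_x f t (x t) *v z t) \<le> L * b" if "t \<ge> 0" for t
      using L(2)[rule_format, OF z b[rule_format] that] .
  qed
qed

end

context stable_system
begin

context
  fixes f :: "real \<times> (real^'n) \<Rightarrow> real^'n" and x :: "real \<Rightarrow> real^'n"
  assumes uc: "\<And>S. compact S \<Longrightarrow> uniformly_continuous_on ({0..} \<times> S) (\<lambda>(t, x). jac_x f t x)"
    and jac_0: "bdd_above ((\<lambda>t. op_norm (jac_x f t 0)) ` {0..})"
    and x: "x \<in> bdd_cont"
begin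

lemma duhamel_jac_x_in_bdd_cont:
  "z \<in> bdd_cont \<Longrightarrow> duhamel \<Phi> (\<lambda>t. jac_x f t (x t) *v z t) \<in> bdd_cont"
  by (intro duhamel_in_bdd_cont jac_x_mult_in_bdd_cont[OF uc jac_0 x])

text \<open>\<open>f\<close> along \<open>x\<close> may be unbounded in time, so its Duhamel
  integral cannot be estimated directly. The difference of \<open>f\<close> along
  \<open>x + z\<close> and along \<open>x\<close> is bounded, by the Jacobian bound on a ball, and
  the assumption \<open>fx\<close> covers the rest.\<close>

lemma duhamel_along_in_bdd_cont:
  assumes f: "cont_differentiable f" and fx: "duhamel \<Phi> (\<lambda>t. f (t, x t)) \<in> bdd_cont" and z: "z \<in> bdd_cont"
  shows "duhamel \<Phi> (\<lambda>t. f (t, x t + z t)) \<in> bdd_cont"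
proof -
  have cont: "continuous_on {0..} (\<lambda>t. f (t, x t + z t))" "continuous_on {0..} (\<lambda>t. f (t, x t))"
    using continuous_on_along[OF f x z] continuous_on_along[OF f x, of "\<lambda>_. 0"]
    by (auto simp: bdd_cont_def image_constant_conv)
  obtain b where b: "\<And>t. t \<ge> 0 \<Longrightarrow> norm (x t) \<le> b" using bdd_cont_bound[OF x] by blast
  obtain c where c: "c > 0" "\<And>t. t \<ge> 0 \<Longrightarrow> norm (z t) \<le> c" using bdd_cont_bound[OF z] by blast
  obtain L where L: "\<And>t z. t \<ge> 0 \<Longrightarrow> norm z \<le> b + c \<Longrightarrow> norm (jac_x f t z) \<le> L"
    using jac_x_bounded[OF uc jac_0, of "b + c"] by blast
  have "norm (f (t, x t + z t) - f (t, x t)) \<le> L * c" if t: "t \<ge> 0" for t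
  proof -
    have L0: "L \<ge> 0" using L[of t "x t"] b[OF t] c(1) t order.trans[OF norm_ge_zero] by simp
    have "norm (f (t, x t + z t) - f (t, x t) - 0 *v (x t + z t - x t)) \<le> L * norm (x t + z t - x t)"
    proof (rule jac_x_linearization[OF f convex_cball[of 0 "b + c"]])
      show "x t + z t \<in> cball 0 (b + c)"
        using b[OF t] c(2)[OF t] norm_triangle_ineq[of "x t" "z t"] by simp
      show "x t \<in> cball 0 (b + c)" using b[OF t] c(1) by simp
      fix v :: "real^'n" assume "v \<in> cball 0 (b + c)"
      then show "op_norm (jac_x f t v - 0) \<le> L"
        using L[OF t, of v] onorm_le_norm_matrix[of "jac_x f t v"] by simp
    qed
    also have "\<dots> \<le> L * c" using L0 c(2)[OF t] by (simp add: mult_left_mono)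
    finally show ?thesis by simp
  qed
  then have "(\<lambda>t. f (t, x t + z t) - f (t, x t)) \<in> bdd_cont"
    by (intro bdd_contI[of _ "L * c"] continuous_on_diff cont)
  from bdd_cont_add[OF fx duhamel_in_bdd_cont[OF this]]
  show ?thesis by (simp add: duhamel_diff[OF cont])
qed

text \<open>The pointwise remainder estimate with tolerance \<open>e * \<alpha> / K\<close> is
  passed through \<open>norm_duhamel_le\<close>, whose factor \<open>K / \<alpha>\<close> restores
  \<open>e\<close>.\<close>

lemma strict_derivative_duhamel:
  assumes f: "cont_differentiable f" and fx: "duhamel \<Phi> (\<lambda>t. f (t, x t)) \<in> bdd_cont"
  shows "strict_derivative_at_0
    (\<lambda>z. bcontfun_of (duhamel \<Phi> (\<lambda>t. f (t, x t + apply_bcontfun z t))))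
    (\<lambda>z. bcontfun_of (duhamel \<Phi> (\<lambda>t. jac_x f t (x t) *v apply_bcontfun z t)))"
  (is "strict_derivative_at_0 ?F ?D")
  unfolding strict_derivative_at_0_def
proof (intro conjI allI impI)
  note in_bdd = apply_bcontfun_in_bdd_cont
  let ?J = "\<lambda>z t. jac_x f t (x t) *v apply_bcontfun z t"
  note D_apply = apply_bcontfun_of[OF duhamel_jac_x_in_bdd_cont[OF in_bdd]]
  note F_apply = apply_bcontfun_of[OF duhamel_along_in_bdd_cont[OF f fx in_bdd]]
  have J_cont: "continuous_on {0..} (?J z)" for z
    by (intro bdd_cont_continuous jac_x_mult_in_bdd_cont[OF uc jac_0 x] in_bdd)
  have F_cont: "continuous_on {0..} (\<lambda>t. f (t, x t + apply_bcontfun z t))" for z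
    by (rule continuous_on_along[OF f x in_bdd])
  obtain L where L: "L \<ge> 0" "\<forall>z\<in>bdd_cont. \<forall>b. (\<forall>t\<ge>0. norm (z t) \<le> b) \<longrightarrow>
      (\<forall>t\<ge>0. norm (jac_x f t (x t) *v z t) \<le> L * b)"
    using jac_x_mult_bounded[OF uc jac_0 x] by blast
  show "bounded_linear ?D"
  proof (rule bounded_linear_intro)
    fix z w :: "real \<Rightarrow>\<^sub>C (real^'n)" and c
    show "?D (z + w) = ?D z + ?D w"
    proof (rule bcontfun_eqI)
      fix t
      have "apply_bcontfun (?D (z + w)) t = duhamel \<Phi> (\<lambda>s. ?J z s + ?J w s) (max 0 t)"
        unfolding D_apply by (simp add: matrix_vector_right_distrib)
      also have "\<dots> = apply_bcontfun (?D z + ?D w) t"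
        by (simp add: D_apply duhamel_add[OF J_cont J_cont])
      finally show "apply_bcontfun (?D (z + w)) t = apply_bcontfun (?D z + ?D w) t" .
    qed
    show "?D (c *\<^sub>R z) = c *\<^sub>R ?D z"
    proof (rule bcontfun_eqI)
      fix t
      have "apply_bcontfun (?D (c *\<^sub>R z)) t = duhamel \<Phi> (\<lambda>s. c *\<^sub>R ?J z s) (max 0 t)"
        unfolding D_apply by (simp add: matrix_vector_mult_scaleR)
      also have "\<dots> = apply_bcontfun (c *\<^sub>R ?D z) t"
        by (simp add: D_apply duhamel_scaleR)
      finally show "apply_bcontfun (?D (c *\<^sub>R z)) t = apply_bcontfun (c *\<^sub>R ?D z) t" .
    qed
    have "norm (duhamel \<Phi> (?J z) t) \<le> K / \<alpha> * (L * norm z)" if "t \<ge> 0" for t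
      using L(2) in_bdd[of z] norm_bounded[of z]
      by (intro norm_duhamel_le[OF J_cont _ that]) blast
    from norm_bcontfun_of_le[OF duhamel_jac_x_in_bdd_cont[OF in_bdd] this]
    show "norm (?D z) \<le> norm z * (K / \<alpha> * L)" by (simp add: mult_ac)
  qed
  fix e :: real assume "e > 0"
  then have "e * \<alpha> / K > 0" using K_pos \<alpha>_pos by simp
  then obtain r where r: "r > 0" "\<And>t v w. t \<ge> 0 \<Longrightarrow> norm v \<le> r \<Longrightarrow> norm w \<le> r \<Longrightarrow>
      norm (f (t, x t + v) - f (t, x t + w) - jac_x f t (x t) *v (v - w)) \<le> e * \<alpha> / K * norm (v - w)"
    using jac_x_strict_estimate[OF f uc x] by blast
  have "norm (?F z - ?F w - ?D (z - w)) \<le> e * norm (z - w)" if "norm z \<le> r" "norm w \<le> r" for z w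
  proof (rule norm_bound)
    fix t
    let ?k = "\<lambda>s. f (s, x s + z s) - f (s, x s + w s) - ?J (z - w) s"
    have "apply_bcontfun (?F z - ?F w - ?D (z - w)) t = duhamel \<Phi> ?k (max 0 t)"
      unfolding duhamel_diff[OF continuous_on_diff[OF F_cont F_cont] J_cont]
        duhamel_diff[OF F_cont F_cont]
      by (simp only: minus_bcontfun.rep_eq[of "?F z - ?F w" "?D (z - w)"]
          minus_bcontfun.rep_eq[of "?F z" "?F w"] F_apply D_apply)
    also have "norm \<dots> \<le> K / \<alpha> * (e * \<alpha> / K * norm (z - w))"
    proof (rule norm_duhamel_le)
      show "continuous_on {0..} ?k" by (intro continuous_on_diff F_cont J_cont)
      fix s :: real assume s: "s \<ge> 0"
      have "norm (?k s) \<le> e * \<alpha> / K * norm (z s - w s)"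
        using r(2)[OF s, of "z s" "w s"] that norm_bounded[of z s] norm_bounded[of w s] by simp
      also have "\<dots> \<le> e * \<alpha> / K * norm (z - w)"
        using norm_bounded[of "z - w" s] \<open>e * \<alpha> / K > 0\<close> by (intro mult_left_mono) auto
      finally show "norm (?k s) \<le> e * \<alpha> / K * norm (z - w)" .
    qed simp
    finally show "norm (apply_bcontfun (?F z - ?F w - ?D (z - w)) t) \<le> e * norm (z - w)"
      using K_pos \<alpha>_pos by simp
  qed
  with r(1) show "\<exists>r>0. \<forall>z w. norm z \<le> r \<longrightarrow> norm w \<le> r \<longrightarrow>
      norm (?F z - ?F w - ?D (z - w)) \<le> e * norm (z - w)"
    by blast
qed

end

end

section \<open>The integral of \<open>g\<close> over the half-line\<close>

lemma integrable_on_if_continuous_dominated: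
  fixes f :: "real \<Rightarrow> 'a::euclidean_space"
  assumes "continuous_on {a..} f" "b integrable_on {a..}" "\<And>t. t \<ge> a \<Longrightarrow> norm (f t) \<le> b t"
  shows "f integrable_on {a..}"
proof -
  have "f \<in> borel_measurable (lebesgue_on {a..})"
    by (intro continuous_imp_measurable_on_sets_lebesgue assms) simp
  then have "f absolutely_integrable_on {a..}"
    by (rule measurable_bounded_by_integrable_imp_absolutely_integrable[OF _ _ assms(2)])
      (use assms(3) in auto)
  then show ?thesis by (rule set_lebesgue_integral_eq_integral(1))
qed

text \<open>The product \<open>pr\<close> is kept abstract because the Jacobian is later multiplied
  both by vectors and by the matrix \<Phi>.\<close>

lemma integrable_on_if_dominated_times_bdd_cont:
  fixes J :: "real \<Rightarrow> 'a::real_normed_vector" and z :: "real \<Rightarrow> 'b::real_normed_vector"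
    and pr :: "'a \<Rightarrow> 'b \<Rightarrow> 'c::euclidean_space"
  assumes pr: "bounded_bilinear pr"
    and J: "continuous_on {0..} J" "b integrable_on {0..}" "\<And>t. t \<ge> 0 \<Longrightarrow> norm (J t) \<le> b t"
    and z: "z \<in> bdd_cont"
  shows "(\<lambda>t. pr (J t) (z t)) integrable_on {0..}"
proof -
  interpret bounded_bilinear pr by fact
  obtain C where C: "C > 0" "\<And>u v. norm (pr u v) \<le> norm u * norm v * C" using pos_bounded by blast
  obtain c where c: "c > 0" "\<And>t. t \<ge> 0 \<Longrightarrow> norm (z t) \<le> c" using bdd_cont_bound[OF z] by blast
  show ?thesis
  proof (rule integrable_on_if_continuous_dominated)
    show "continuous_on {0..} (\<lambda>t. pr (J t) (z t))"
      by (intro continuous_on J(1) bdd_cont_continuous z)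
    show "(\<lambda>t. b t * c * C) integrable_on {0..}"
      using J(2) by (intro integrable_on_mult_left)
    fix t :: real assume t: "t \<ge> 0"
    have "norm (J t) * norm (z t) \<le> b t * c"
      using J(3)[OF t] c t order.trans[OF norm_ge_zero J(3)[OF t]] by (intro mult_mono) auto
    then show "norm (pr (J t) (z t)) \<le> b t * c * C"
      using C(1) by (intro order.trans[OF C(2)] mult_right_mono) auto
  qed
qed

lemma integrable_along:
  fixes g :: "real \<times> (real^'n) \<Rightarrow> real^'m"
  assumes g: "cont_differentiable g"
    and g_int: "\<And>\<eta>. \<eta> \<in> bdd_cont \<Longrightarrow> (\<lambda>t. norm (g (t, \<eta> t))) integrable_on {0..}"
    and x: "x \<in> bdd_cont" and z: "z \<in> bdd_cont"
  shows "(\<lambda>t. g (t, x t + z t)) integrable_on {0..}"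
  by (rule integrable_on_if_continuous_dominated[OF continuous_on_along[OF g x z]
        g_int[OF bdd_cont_add[OF x z]] order.refl])

context
  fixes g :: "real \<times> (real^'n) \<Rightarrow> real^'m" and x :: "real \<Rightarrow> real^'n" and s :: "real \<Rightarrow> real"
  assumes uc: "\<And>S. compact S \<Longrightarrow> uniformly_continuous_on ({0..} \<times> S) (\<lambda>(t, x). jac_x g t x)"
    and jac_0: "(\<lambda>t. op_norm (jac_x g t 0)) integrable_on {0..}"
    and s: "s absolutely_integrable_on {0..}"
    and jac_lipschitz:
      "\<And>t v w. t \<ge> 0 \<Longrightarrow> op_norm (jac_x g t v - jac_x g t w) \<le> s t * norm (v - w)"
    and x: "x \<in> bdd_cont"
begin

text \<open>Comparison with the Jacobian at 0 through the Lipschitz hypothesis: a bound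
  \<open>c\<close> for \<open>x\<close> adds at most \<open>\<bar>s t\<bar> * c\<close>, and both
  summands are integrable.\<close>

lemma jac_x_dominated:
  obtains b where "b integrable_on {0..}" "\<And>t. t \<ge> 0 \<Longrightarrow> norm (jac_x g t (x t)) \<le> b t"
proof -
  obtain c where c: "c > 0" "\<And>t. t \<ge> 0 \<Longrightarrow> norm (x t) \<le> c" using bdd_cont_bound[OF x] by blast
  have "(\<lambda>t. \<bar>s t\<bar>) integrable_on {0..}"
    using s unfolding absolutely_integrable_on_def by simp
  then have "(\<lambda>t. real CARD('m) * real CARD('n) * (op_norm (jac_x g t 0) + \<bar>s t\<bar> * c))
      integrable_on {0..}"
    by (intro integrable_on_mult_right integrable_add jac_0 integrable_on_mult_left)
  moreover have "norm (jac_x g t (x t))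
      \<le> real CARD('m) * real CARD('n) * (op_norm (jac_x g t 0) + \<bar>s t\<bar> * c)" if t: "t \<ge> 0" for t
  proof -
    have "op_norm (jac_x g t (x t)) = op_norm (jac_x g t 0 + (jac_x g t (x t) - jac_x g t 0))"
      by simp
    also have "\<dots> \<le> op_norm (jac_x g t 0) + op_norm (jac_x g t (x t) - jac_x g t 0)"
      unfolding matrix_vector_mult_add_rdistrib
      by (intro onorm_triangle matrix_vector_mul_bounded_linear)
    also have "op_norm (jac_x g t (x t) - jac_x g t 0) \<le> s t * norm (x t)"
      using jac_lipschitz[OF t, of "x t" 0] by simp
    also have "s t * norm (x t) \<le> \<bar>s t\<bar> * c"
      using c t by (intro mult_mono) auto
    finally have "op_norm (jac_x g t (x t)) \<le> op_norm (jac_x g t 0) + \<bar>s t\<bar> * c" by simp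
    then have "real CARD('m) * real CARD('n) * op_norm (jac_x g t (x t))
        \<le> real CARD('m) * real CARD('n) * (op_norm (jac_x g t 0) + \<bar>s t\<bar> * c)"
      by (intro mult_left_mono) auto
    with norm_matrix_le_onorm show ?thesis by (rule order.trans)
  qed
  ultimately show ?thesis by (rule that)
qed

lemma jac_x_times_integrable:
  fixes pr :: "real^'n^'m \<Rightarrow> 'b::real_normed_vector \<Rightarrow> 'c::euclidean_space"
  assumes pr: "bounded_bilinear pr" and z: "z \<in> bdd_cont"
  shows "(\<lambda>t. pr (jac_x g t (x t)) (z t)) integrable_on {0..}"
proof -
  obtain b where b: "b integrable_on {0..}" "\<And>t. t \<ge> 0 \<Longrightarrow> norm (jac_x g t (x t)) \<le> b t"
    using jac_x_dominated by blast
  show ?thesis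
    by (rule integrable_on_if_dominated_times_bdd_cont[OF pr continuous_on_jac_x_along[OF uc x] b z])
qed

lemmas jac_x_mult_integrable = jac_x_times_integrable[OF bounded_bilinear_matrix_vector_mult]

text \<open>A remainder bound uniform in time would not be integrable over the half-line. The
  Lipschitz hypothesis instead bounds the remainder by \<open>r * \<bar>s t\<bar>\<close> times the
  distance, and its integral is small with \<open>r\<close>.\<close>

lemma strict_derivative_integral:
  assumes g: "cont_differentiable g"
    and g_int: "\<And>\<eta>. \<eta> \<in> bdd_cont \<Longrightarrow> (\<lambda>t. norm (g (t, \<eta> t))) integrable_on {0..}"
  shows "strict_derivative_at_0
    (\<lambda>z. integral {0..} (\<lambda>t. g (t, x t + apply_bcontfun z t)))
    (\<lambda>z. integral {0..} (\<lambda>t. jac_x g t (x t) *v apply_bcontfun z t))"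
  (is "strict_derivative_at_0 ?G ?D")
  unfolding strict_derivative_at_0_def
proof (intro conjI allI impI)
  note in_bdd = apply_bcontfun_in_bdd_cont
  note J_int = jac_x_mult_integrable[OF in_bdd]
  note G_int = integrable_along[OF g g_int x in_bdd]
  obtain b where b: "b integrable_on {0..}" "\<And>t. t \<ge> 0 \<Longrightarrow> norm (jac_x g t (x t)) \<le> b t"
    using jac_x_dominated by blast
  have b0: "b t \<ge> 0" if "t \<ge> 0" for t
    using order.trans[OF norm_ge_zero b(2)[OF that]] .
  show "bounded_linear ?D"
  proof (rule bounded_linear_intro)
    fix z w :: "real \<Rightarrow>\<^sub>C (real^'n)" and c
    show "?D (z + w) = ?D z + ?D w"
      by (simp add: matrix_vector_right_distrib integral_add[OF J_int J_int])
    show "?D (c *\<^sub>R z) = c *\<^sub>R ?D z"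
      by (simp add: matrix_vector_mult_scaleR)
    have "norm (?D z) \<le> integral {0..} (\<lambda>t. norm z * b t)"
    proof (rule integral_norm_bound_integral[OF J_int])
      show "(\<lambda>t. norm z * b t) integrable_on {0..}"
        using b(1) by (rule integrable_on_mult_right)
      fix t :: real assume "t \<in> {0..}"
      then have t: "t \<ge> 0" by simp
      have "norm (jac_x g t (x t) *v z t) \<le> norm (jac_x g t (x t)) * norm (z t)"
        by (rule norm_matrix_vector_mult_le_norm)
      also have "\<dots> \<le> b t * norm z"
        using b(2)[OF t] b0[OF t] norm_bounded[of z t] by (intro mult_mono) auto
      finally show "norm (jac_x g t (x t) *v z t) \<le> norm z * b t" by (simp add: mult.commute)
    qed
    then show "norm (?D z) \<le> norm z * integral {0..} b" by simp
  qed
  have s_int: "(\<lambda>t. \<bar>s t\<bar>) integrable_on {0..}"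
    using s unfolding absolutely_integrable_on_def by simp
  define I where "I = integral {0..} (\<lambda>t. \<bar>s t\<bar>)"
  have I: "I \<ge> 0" unfolding I_def by (rule integral_nonneg[OF s_int]) simp
  fix e :: real assume e: "e > 0"
  \<comment> \<open>Chosen so that \<open>r * I \<le> e\<close>; the added 1 covers
    \<open>I = 0\<close>.\<close>
  define r where "r = e / (I + 1)"
  have r: "r > 0" "r * I \<le> e" using e I by (auto simp: r_def field_simps)
  have "norm (?G z - ?G w - ?D (z - w)) \<le> e * norm (z - w)" if zw: "norm z \<le> r" "norm w \<le> r" for z w
  proof -
    let ?k = "\<lambda>t. g (t, x t + z t) - g (t, x t + w t) - jac_x g t (x t) *v apply_bcontfun (z - w) t"
    have "?G z - ?G w - ?D (z - w) = integral {0..} ?k"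
      by (simp only: integral_diff G_int J_int integrable_diff)
    also have "norm \<dots> \<le> integral {0..} (\<lambda>t. r * norm (z - w) * \<bar>s t\<bar>)"
    proof (rule integral_norm_bound_integral)
      show "?k integrable_on {0..}" by (intro integrable_diff G_int J_int)
      show "(\<lambda>t. r * norm (z - w) * \<bar>s t\<bar>) integrable_on {0..}"
        using s_int by (rule integrable_on_mult_right)
      fix t :: real assume "t \<in> {0..}"
      then have t: "t \<ge> 0" by simp
      have "norm (g (t, x t + z t) - g (t, x t + w t) - jac_x g t (x t) *v (x t + z t - (x t + w t)))
          \<le> \<bar>s t\<bar> * r * norm (x t + z t - (x t + w t))"
      proof (rule jac_x_linearization[OF g convex_cball[of "x t" r]])
        fix v assume "v \<in> cball (x t) r"
        then have "s t * norm (v - x t) \<le> \<bar>s t\<bar> * r"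
          by (intro mult_mono) (auto simp: dist_norm norm_minus_commute)
        with jac_lipschitz[OF t] show "op_norm (jac_x g t v - jac_x g t (x t)) \<le> \<bar>s t\<bar> * r"
          by (rule order.trans)
      qed (use zw norm_bounded[of z t] norm_bounded[of w t] in \<open>auto simp: dist_norm\<close>)
      then have "norm (?k t) \<le> \<bar>s t\<bar> * r * norm (z t - w t)" by simp
      also have "\<dots> \<le> \<bar>s t\<bar> * r * norm (z - w)"
        using norm_bounded[of "z - w" t] r(1) by (intro mult_left_mono) auto
      finally show "norm (?k t) \<le> r * norm (z - w) * \<bar>s t\<bar>" by (simp add: mult_ac)
    qed
    also have "\<dots> = r * I * norm (z - w)" by (simp add: I_def)
    also have "\<dots> \<le> e * norm (z - w)" using r(2) by (intro mult_right_mono) auto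
    finally show ?thesis .
  qed
  with r(1) show "\<exists>r>0. \<forall>z w. norm z \<le> r \<longrightarrow> norm w \<le> r \<longrightarrow>
      norm (?G z - ?G w - ?D (z - w)) \<le> e * norm (z - w)"
    by blast
qed

end

section \<open>The boundary value problem\<close>

text \<open>Assumption \<open>y\<close> says that \<open>x\<^sub>y\<close> meets the boundary
  condition of the problem at \<epsilon> = 0; it reduces to membership in the kernel of \<Lambda>
  when \<open>u = \<Gamma> (duhamel \<Phi> h)\<close>. Assumption \<open>f_term\<close> places the
  Duhamel integral in the space where \<Gamma> is constrained; a bound on the Jacobian at
  \<open>x = 0\<close> does not limit the growth of \<open>f (t, 0)\<close>.\<close>

theorem theorem1:
  fixes A \<Phi> :: "real \<Rightarrow> real^'n^'n"
    and h :: "real \<Rightarrow> real^'n"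
    and u y :: "real^'n"
    and f g :: "real \<times> (real^'n) \<Rightarrow> real^'n"
    and \<Gamma> :: "(real \<Rightarrow> real^'n) \<Rightarrow> real^'n"
    and \<Lambda> :: "real^'n^'n"
    and W :: "real^'p^'n"
    and K \<alpha> :: real
    and s :: "real \<Rightarrow> real"
    and x\<^sub>y :: "real \<Rightarrow> real^'n"
  assumes A: "continuous_on {0..} A"
    and h: "h \<in> bdd_cont"
    and f: "cont_differentiable f"
    and g: "cont_differentiable g"
    and \<Gamma>: "bounded_linear_on_bdd_cont \<Gamma>"
    and \<Phi>: "fundamental_matrix A \<Phi>"
    and \<Lambda>: "\<Lambda> = columnwise \<Gamma> \<Phi>"
    and singular: "\<not> invertible \<Lambda>"
    and p: "CARD('p) = dim (mat_kernel \<Lambda>)"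
    and W: "columns_basis_of W (mat_kernel (transpose \<Lambda>))"
    and linear_solvable: "\<exists>x\<in>bdd_cont. solves_lin_ode A h x \<and> \<Gamma> x = u"
    and H1: "K > 0" "\<alpha> > 0"
      "\<And>t s. t \<ge> s \<Longrightarrow> s \<ge> 0 \<Longrightarrow> op_norm (\<Phi> t ** matrix_inv (\<Phi> s)) \<le> K * exp (- \<alpha> * (t - s))"
    and H2: "\<And>S. compact S \<Longrightarrow> uniformly_continuous_on ({0..} \<times> S) (\<lambda>(t, x). jac_x f t x)"
      "bdd_above ((\<lambda>t. op_norm (jac_x f t 0)) ` {0..})"
    and H3: "\<And>S. compact S \<Longrightarrow> uniformly_continuous_on ({0..} \<times> S) (\<lambda>(t, x). jac_x g t x)"
      "(\<lambda>t. op_norm (jac_x g t 0)) integrable_on {0..}"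
    and H4: "\<And>\<eta>. \<eta> \<in> bdd_cont \<Longrightarrow> (\<lambda>t. norm (g (t, \<eta> t))) integrable_on {0..}"
    and H5: "s absolutely_integrable_on {0..}"
      "\<And>t x\<^sub>1 x\<^sub>2. t \<ge> 0 \<Longrightarrow> op_norm (jac_x g t x\<^sub>1 - jac_x g t x\<^sub>2) \<le> s t * norm (x\<^sub>1 - x\<^sub>2)"
    and x\<^sub>y: "x\<^sub>y = (\<lambda>t. \<Phi> t *v y + duhamel \<Phi> h t)"
    and y: "\<Lambda> *v y = u - \<Gamma> (duhamel \<Phi> h)"
    and f_term: "duhamel \<Phi> (\<lambda>t. f (t, x\<^sub>y t)) \<in> bdd_cont"
    and bifurcation: "transpose W *v
      (integral {0..} (\<lambda>t. g (t, x\<^sub>y t)) - \<Gamma> (duhamel \<Phi> (\<lambda>t. f (t, x\<^sub>y t)))) = 0"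
    and nondegenerate: "bij_betw
      (\<lambda>w. (transpose W **
              (integral {0..} (\<lambda>t. jac_x g t (x\<^sub>y t) ** \<Phi> t)
               - columnwise \<Gamma> (duhamel_mat \<Phi> (\<lambda>t. jac_x f t (x\<^sub>y t) ** \<Phi> t)))) *v w)
      (mat_kernel \<Lambda>) (UNIV :: (real^'p) set)"
  shows "\<exists>\<epsilon>\<^sub>0>0. \<exists>X :: real \<Rightarrow> real \<Rightarrow> real^'n.
    (\<forall>\<epsilon>. \<bar>\<epsilon>\<bar> \<le> \<epsilon>\<^sub>0 \<longrightarrow>
       X \<epsilon> \<in> bdd_cont \<and>
       solves_lin_ode A (\<lambda>t. h t + \<epsilon> *\<^sub>R f (t, X \<epsilon> t)) (X \<epsilon>) \<and>
       \<Gamma> (X \<epsilon>) = u + \<epsilon> *\<^sub>R integral {0..} (\<lambda>t. g (t, X \<epsilon> t))) \<and>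
    ((\<lambda>\<epsilon>. sup_norm (\<lambda>t. X \<epsilon> t - x\<^sub>y t)) \<longlongrightarrow> 0) (at 0)"
proof -
  interpret stable_system A \<Phi> K \<alpha>
    by unfold_locales (use A \<Phi> H1 in auto)
  note jac_lipschitz = H5(2)
  note in_bdd = apply_bcontfun_in_bdd_cont
  have x\<^sub>y_bdd: "x\<^sub>y \<in> bdd_cont"
    unfolding x\<^sub>y by (intro bdd_cont_add fundamental_mult_in_bdd_cont duhamel_in_bdd_cont h)

  \<comment> \<open>The nonlinear operators centred at \<open>x\<^sub>y\<close> and their
    derivatives at 0\<close>
  define D where "D z = bcontfun_of (duhamel \<Phi> (\<lambda>t. f (t, x\<^sub>y t + apply_bcontfun z t)))" for z
  define D' where "D' z = bcontfun_of (duhamel \<Phi> (\<lambda>t. jac_x f t (x\<^sub>y t) *v apply_bcontfun z t))" for z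
  define G where "G z = integral {0..} (\<lambda>t. g (t, x\<^sub>y t + apply_bcontfun z t))" for z
  define G' where "G' z = integral {0..} (\<lambda>t. jac_x g t (x\<^sub>y t) *v apply_bcontfun z t)" for z
  define E where "E z = G z - \<Gamma> (apply_bcontfun (D z))" for z
  define E' where "E' z = G' z - \<Gamma> (apply_bcontfun (D' z))" for z
  have D: "strict_derivative_at_0 D D'"
    unfolding D_def D'_def by (rule strict_derivative_duhamel[OF H2 x\<^sub>y_bdd f f_term])
  have G: "strict_derivative_at_0 G G'"
    unfolding G_def G'_def
    by (rule strict_derivative_integral[OF H3 H5(1) jac_lipschitz x\<^sub>y_bdd g H4])
  have E: "strict_derivative_at_0 E E'"
    unfolding E_def E'_def
    by (intro strict_derivative_at_0_diff G strict_derivative_at_0_compose_linear[OF _ D]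
        bounded_linear_on_bcontfun \<Gamma>)
  have H: "strict_derivative_at_0 (\<lambda>z. transpose W *v E z) (\<lambda>z. transpose W *v E' z)"
    by (rule strict_derivative_at_0_compose_linear[OF matrix_vector_mul_bounded_linear E])
  have \<Gamma>D: "\<Gamma> (apply_bcontfun (D z)) = \<Gamma> (duhamel \<Phi> (\<lambda>t. f (t, x\<^sub>y t + apply_bcontfun z t)))" for z
    unfolding D_def
    by (intro bounded_linear_on_bdd_cont_bcontfun_of \<Gamma>
        duhamel_along_in_bdd_cont[OF H2 x\<^sub>y_bdd f f_term in_bdd])
  have H0: "transpose W *v E 0 = 0"
    using bifurcation by (simp add: E_def \<Gamma>D G_def)

  \<comment> \<open>\<open>L\<close> is linear on the whole space, so it can be composed with
    \<open>E\<close>; it inverts \<Lambda> only on the range, where \<open>E z\<close> lies once its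
    product with the transpose of \<open>W\<close> vanishes.\<close>
  have "\<exists>L. L ` UNIV \<subseteq> UNIV \<and> linear L \<and> (\<forall>v\<in>(*v) \<Lambda> ` UNIV. \<Lambda> *v L v = v)"
    by (rule linear_exists_right_inverse_on) auto
  then obtain L where L: "linear L" "\<And>v. v \<in> range ((*v) \<Lambda>) \<Longrightarrow> \<Lambda> *v L v = v" by blast
  \<comment> \<open>\<open>M\<close> is the matrix of \<phi>. Surjectivity of \<phi> yields a linear
    \<open>R\<close> into the kernel of \<Lambda> with \<open>M *v R q = q\<close> for every
    \<open>q\<close>.\<close>
  define M where "M = transpose W ** (integral {0..} (\<lambda>t. jac_x g t (x\<^sub>y t) ** \<Phi> t)
      - columnwise \<Gamma> (duhamel_mat \<Phi> (\<lambda>t. jac_x f t (x\<^sub>y t) ** \<Phi> t)))"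
  have "subspace (mat_kernel \<Lambda>)"
    by (auto simp: subspace_def mat_kernel_def matrix_vector_right_distrib matrix_vector_mult_scaleR)
  then have "\<exists>R. R ` UNIV \<subseteq> mat_kernel \<Lambda> \<and> linear R \<and>
      (\<forall>q\<in>(*v) M ` mat_kernel \<Lambda>. M *v R q = q)"
    by (intro linear_exists_right_inverse_on) auto
  then obtain R where R\<^sub>0: "range R \<subseteq> mat_kernel \<Lambda>" "linear R"
      "\<forall>q\<in>(*v) M ` mat_kernel \<Lambda>. M *v R q = q"
    by blast
  have "(*v) M ` mat_kernel \<Lambda> = UNIV"
    using nondegenerate unfolding M_def bij_betw_def by blast
  then have R: "linear R" "\<And>q. \<Lambda> *v R q = 0" "\<And>q. M *v R q = q"
    using R\<^sub>0 by (auto simp: mat_kernel_def)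

  \<comment> \<open>\<open>S\<^sub>1\<close> sends an initial vector to the homogeneous solution it
    generates; composed with \<open>R\<close> it becomes the \<open>S\<close> of the abstract
    bifurcation lemma.\<close>
  define S\<^sub>1 where "S\<^sub>1 v = bcontfun_of (\<lambda>t. \<Phi> t *v v)" for v
  have S\<^sub>1_apply: "apply_bcontfun (S\<^sub>1 v) t = \<Phi> (max 0 t) *v v" for v t
    unfolding S\<^sub>1_def by (rule apply_bcontfun_of[OF fundamental_mult_in_bdd_cont])
  have S\<^sub>1: "bounded_linear S\<^sub>1"
  proof (rule bounded_linear_intro)
    show "norm (S\<^sub>1 v) \<le> norm v * K" for v
      unfolding S\<^sub>1_def
      by (rule norm_bcontfun_of_le[OF fundamental_mult_in_bdd_cont])
        (use norm_fundamental_mult_le in \<open>simp add: mult.commute\<close>)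
  qed (auto intro!: bcontfun_eqI simp: S\<^sub>1_apply matrix_vector_right_distrib matrix_vector_mult_scaleR)
  have S: "bounded_linear (\<lambda>q. S\<^sub>1 (R q))"
    by (rule bounded_linear_compose[OF S\<^sub>1]) (simp add: R(1) linear_conv_bounded_linear[symmetric])
  \<comment> \<open>In \<open>T\<close>, the term \<open>D z\<close> is the response to the forcing,
    and \<open>S\<^sub>1 (L (E z))\<close> adjusts the initial vector to meet the boundary
    condition.\<close>
  have T: "strict_derivative_at_0 (\<lambda>z. S\<^sub>1 (L (E z)) + D z) (\<lambda>z. S\<^sub>1 (L (E' z)) + D' z)"
    by (intro strict_derivative_at_0_add D strict_derivative_at_0_compose_linear[OF S\<^sub>1]
        strict_derivative_at_0_compose_linear[OF _ E])
      (simp add: L(1) linear_conv_bounded_linear[symmetric])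

  \<comment> \<open>Taking \<open>w\<close> out of the integral, of the Duhamel operator and of
    \<Gamma> identifies \<open>E'\<close> along homogeneous solutions with the matrix in
    \<open>nondegenerate\<close>.\<close>
  have E'_S\<^sub>1: "E' (S\<^sub>1 w) = (integral {0..} (\<lambda>t. jac_x g t (x\<^sub>y t) ** \<Phi> t)
      - columnwise \<Gamma> (duhamel_mat \<Phi> (\<lambda>t. jac_x f t (x\<^sub>y t) ** \<Phi> t))) *v w" for w
  proof -
    have "G' (S\<^sub>1 w) = integral {0..} (\<lambda>t. (jac_x g t (x\<^sub>y t) ** \<Phi> t) *v w)"
      unfolding G'_def by (rule integral_cong) (simp add: S\<^sub>1_apply matrix_vector_mul_assoc)
    also have "\<dots> = integral {0..} (\<lambda>t. jac_x g t (x\<^sub>y t) ** \<Phi> t) *v w"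
      using integral_linear[OF jac_x_times_integrable[OF H3 H5(1) jac_lipschitz x\<^sub>y_bdd
            bounded_bilinear_matrix_matrix_mult fundamental_in_bdd_cont]
          bounded_bilinear.bounded_linear_left[OF bounded_bilinear_matrix_vector_mult], of w]
      by (simp add: o_def)
    finally have G'_eq: "G' (S\<^sub>1 w) = integral {0..} (\<lambda>t. jac_x g t (x\<^sub>y t) ** \<Phi> t) *v w" .
    have mult: "duhamel_mat \<Phi> (\<lambda>t. jac_x f t (x\<^sub>y t) ** \<Phi> t) t *v v
        = duhamel \<Phi> (\<lambda>t. jac_x f t (x\<^sub>y t) *v (\<Phi> t *v v)) t" for v t
      by (subst duhamel_mat_mult)
        (auto intro!: continuous_on_matrix_matrix_mult continuous_on_fundamental
          continuous_on_jac_x_along[OF H2(1) x\<^sub>y_bdd] simp: matrix_vector_mul_assoc)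
    have in_bdd': "duhamel \<Phi> (\<lambda>t. jac_x f t (x\<^sub>y t) *v (\<Phi> t *v v)) \<in> bdd_cont" for v
      by (rule duhamel_jac_x_in_bdd_cont[OF H2 x\<^sub>y_bdd fundamental_mult_in_bdd_cont])
    have "duhamel \<Phi> (\<lambda>t. jac_x f t (x\<^sub>y t) *v apply_bcontfun (S\<^sub>1 w) t)
        = duhamel \<Phi> (\<lambda>t. jac_x f t (x\<^sub>y t) *v (\<Phi> t *v w))"
      unfolding duhamel_def by (intro ext arg_cong[of _ _ "(*v) _"] integral_cong) (simp add: S\<^sub>1_apply)
    then have "\<Gamma> (apply_bcontfun (D' (S\<^sub>1 w)))
        = \<Gamma> (duhamel \<Phi> (\<lambda>t. jac_x f t (x\<^sub>y t) *v (\<Phi> t *v w)))"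
      unfolding D'_def by (simp add: bounded_linear_on_bdd_cont_bcontfun_of[OF \<Gamma> in_bdd'])
    also have "\<dots> = columnwise \<Gamma> (duhamel_mat \<Phi> (\<lambda>t. jac_x f t (x\<^sub>y t) ** \<Phi> t)) *v w"
      by (subst columnwise_mult[OF \<Gamma>]) (simp_all add: mult in_bdd')
    finally show ?thesis
      by (simp add: E'_def G'_eq matrix_vector_mult_diff_rdistrib)
  qed
  have H'_S: "transpose W *v E' (S\<^sub>1 (R q)) = q" for q
    using R(3)[of q] by (simp add: E'_S\<^sub>1 M_def matrix_vector_mul_assoc)

  obtain \<epsilon>\<^sub>0 C where \<epsilon>\<^sub>0: "\<epsilon>\<^sub>0 > 0" and "\<forall>\<epsilon>. \<bar>\<epsilon>\<bar> \<le> \<epsilon>\<^sub>0 \<longrightarrow> (\<exists>z q. norm z \<le> C * \<bar>\<epsilon>\<bar> \<and>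
      transpose W *v E z = 0 \<and> z = S\<^sub>1 (R q) + \<epsilon> *\<^sub>R (S\<^sub>1 (L (E z)) + D z))"
    using bifurcation_from_zero[of "\<lambda>z. transpose W *v E z" "\<lambda>z. transpose W *v E' z"
        "\<lambda>z. S\<^sub>1 (L (E z)) + D z" "\<lambda>z. S\<^sub>1 (L (E' z)) + D' z" "\<lambda>q. S\<^sub>1 (R q)", OF H H0 T S H'_S]
    by blast
  then obtain z q where zq: "\<And>\<epsilon>. \<bar>\<epsilon>\<bar> \<le> \<epsilon>\<^sub>0 \<Longrightarrow> norm (z \<epsilon>) \<le> C * \<bar>\<epsilon>\<bar> \<and>
      transpose W *v E (z \<epsilon>) = 0 \<and> z \<epsilon> = S\<^sub>1 (R (q \<epsilon>)) + \<epsilon> *\<^sub>R (S\<^sub>1 (L (E (z \<epsilon>))) + D (z \<epsilon>))"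
    by metis
  define X where "X \<epsilon> t = x\<^sub>y t + apply_bcontfun (z \<epsilon>) t" for \<epsilon> t

  \<comment> \<open>Verification of the boundary value problem\<close>
  have "X \<epsilon> \<in> bdd_cont \<and> solves_lin_ode A (\<lambda>t. h t + \<epsilon> *\<^sub>R f (t, X \<epsilon> t)) (X \<epsilon>) \<and>
      \<Gamma> (X \<epsilon>) = u + \<epsilon> *\<^sub>R integral {0..} (\<lambda>t. g (t, X \<epsilon> t))" if \<epsilon>: "\<bar>\<epsilon>\<bar> \<le> \<epsilon>\<^sub>0" for \<epsilon>
  proof (intro conjI)
    let ?F = "\<lambda>t. f (t, X \<epsilon> t)"
    define k where "k t = h t + \<epsilon> *\<^sub>R ?F t" for t
    \<comment> \<open>The initial vector of the solution: that of \<open>x\<^sub>y\<close>, the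
      kernel component, and the correction by \<open>L\<close>. With it the solution is \<Phi> c
      plus the Duhamel integral of the full forcing \<open>k\<close>.\<close>
    define c where "c = y + R (q \<epsilon>) + \<epsilon> *\<^sub>R L (E (z \<epsilon>))"
    show X_bdd: "X \<epsilon> \<in> bdd_cont"
      unfolding X_def[abs_def] by (intro bdd_cont_add x\<^sub>y_bdd in_bdd)
    have F_cont: "continuous_on {0..} ?F"
      unfolding X_def by (rule continuous_on_along[OF f x\<^sub>y_bdd in_bdd])
    have h_cont: "continuous_on {0..} h" using h by (rule bdd_cont_continuous)
    have k_cont: "continuous_on {0..} k"
      unfolding k_def by (intro continuous_intros F_cont h_cont)
    have dF_bdd: "duhamel \<Phi> ?F \<in> bdd_cont"
      unfolding X_def by (rule duhamel_along_in_bdd_cont[OF H2 x\<^sub>y_bdd f f_term in_bdd])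
    have dk: "duhamel \<Phi> k t = duhamel \<Phi> h t + \<epsilon> *\<^sub>R duhamel \<Phi> ?F t" for t
      unfolding k_def
      by (subst duhamel_add[OF h_cont]) (auto intro!: continuous_intros F_cont simp: duhamel_scaleR)
    have X_eq: "X \<epsilon> t = \<Phi> t *v c + duhamel \<Phi> k t" if t: "t \<ge> 0" for t
    proof -
      have "z \<epsilon> = S\<^sub>1 (R (q \<epsilon>)) + \<epsilon> *\<^sub>R (S\<^sub>1 (L (E (z \<epsilon>))) + D (z \<epsilon>))"
        using zq[OF \<epsilon>] by blast
      from arg_cong[OF this, of "\<lambda>w. apply_bcontfun w t"]
      have "apply_bcontfun (z \<epsilon>) t =
          \<Phi> t *v R (q \<epsilon>) + \<epsilon> *\<^sub>R (\<Phi> t *v L (E (z \<epsilon>)) + apply_bcontfun (D (z \<epsilon>)) t)"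
        using t by (simp add: S\<^sub>1_apply)
      also have "apply_bcontfun (D (z \<epsilon>)) t = duhamel \<Phi> ?F t"
        using apply_bcontfun_of[OF dF_bdd, of t] t by (simp add: D_def X_def)
      finally show ?thesis
        by (simp add: X_def x\<^sub>y c_def dk matrix_vector_right_distrib matrix_vector_mult_scaleR
            scaleR_add_right)
    qed
    show "solves_lin_ode A (\<lambda>t. h t + \<epsilon> *\<^sub>R f (t, X \<epsilon> t)) (X \<epsilon>)"
      unfolding solves_lin_ode_def
    proof (intro allI impI)
      fix t :: real assume t: "t \<ge> 0"
      have "(duhamel \<Phi> k has_vector_derivative A t *v duhamel \<Phi> k t + k t) (at t within {0..})"
        using solves_duhamel[OF k_cont] t by (simp add: solves_lin_ode_def)
      from has_vector_derivative_add[OF has_vector_derivative_fundamental_mult[OF t, of c] this]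
      have "((\<lambda>t. \<Phi> t *v c + duhamel \<Phi> k t) has_vector_derivative A t *v X \<epsilon> t + k t)
          (at t within {0..})"
        using t by (simp add: X_eq matrix_vector_right_distrib add.assoc)
      then have "(X \<epsilon> has_vector_derivative A t *v X \<epsilon> t + k t) (at t within {0..})"
        by (rule has_vector_derivative_transform[rotated 2]) (use t X_eq in auto)
      then show "(X \<epsilon> has_vector_derivative A t *v X \<epsilon> t + (h t + \<epsilon> *\<^sub>R f (t, X \<epsilon> t)))
          (at t within {0..})"
        by (simp add: k_def)
    qed
    have "\<Gamma> (X \<epsilon>) = \<Gamma> (\<lambda>t. \<Phi> t *v c + (duhamel \<Phi> h t + \<epsilon> *\<^sub>R duhamel \<Phi> ?F t))"
      using X_eq dk
      by (intro bounded_linear_on_bdd_cont_cong[OF \<Gamma>] bdd_cont_add bdd_cont_scaleR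
          fundamental_mult_in_bdd_cont duhamel_in_bdd_cont h dF_bdd) simp
    also have "\<dots> = \<Gamma> (\<lambda>t. \<Phi> t *v c) + (\<Gamma> (duhamel \<Phi> h) + \<epsilon> *\<^sub>R \<Gamma> (duhamel \<Phi> ?F))"
      by (simp only: bounded_linear_on_bdd_cont_add[OF \<Gamma>] bounded_linear_on_bdd_cont_scaleR[OF \<Gamma>]
          bdd_cont_add bdd_cont_scaleR fundamental_mult_in_bdd_cont duhamel_in_bdd_cont h dF_bdd)
    also have "\<Gamma> (\<lambda>t. \<Phi> t *v c) = \<Lambda> *v c"
      unfolding \<Lambda> by (rule columnwise_mult[OF \<Gamma> fundamental_mult_in_bdd_cont, symmetric])
    \<comment> \<open>\<Lambda> kills the kernel component, turns \<open>y\<close> into the linear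
      boundary data, and undoes \<open>L\<close> on \<open>E (z \<epsilon>)\<close>. The two Duhamel
      contributions then cancel against those in \<Gamma> of the solution, leaving \<open>u\<close>
      and the integral of \<open>g\<close>.\<close>
    also have "\<Lambda> *v c = u - \<Gamma> (duhamel \<Phi> h) + \<epsilon> *\<^sub>R E (z \<epsilon>)"
    proof -
      have "E (z \<epsilon>) \<in> range ((*v) \<Lambda>)"
        using range_if_orthogonal_to_cokernel[OF W] zq[OF \<epsilon>] by blast
      then show ?thesis
        by (simp add: c_def matrix_vector_right_distrib matrix_vector_mult_scaleR y R(2) L(2))
    qed
    also have "E (z \<epsilon>) = integral {0..} (\<lambda>t. g (t, X \<epsilon> t)) - \<Gamma> (duhamel \<Phi> ?F)"
      by (simp add: E_def G_def \<Gamma>D X_def)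
    finally show "\<Gamma> (X \<epsilon>) = u + \<epsilon> *\<^sub>R integral {0..} (\<lambda>t. g (t, X \<epsilon> t))"
      by (simp add: scaleR_diff_right)
  qed
  \<comment> \<open>The deviation from \<open>x\<^sub>y\<close> is \<open>z \<epsilon>\<close>
    itself, so the linear bound on the fixed point gives convergence of order \<epsilon>.\<close>
  moreover have "((\<lambda>\<epsilon>. sup_norm (\<lambda>t. X \<epsilon> t - x\<^sub>y t)) \<longlongrightarrow> 0) (at 0)"
  proof (rule Lim_null_comparison)
    have "\<forall>\<^sub>F \<epsilon> in at 0. \<bar>\<epsilon>\<bar> \<le> \<epsilon>\<^sub>0"
      using \<epsilon>\<^sub>0 by (auto simp: eventually_at dist_norm intro!: exI[of _ \<epsilon>\<^sub>0])
    then show "\<forall>\<^sub>F \<epsilon> in at 0. norm (sup_norm (\<lambda>t. X \<epsilon> t - x\<^sub>y t)) \<le> C * \<bar>\<epsilon>\<bar>"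
    proof eventually_elim
      case (elim \<epsilon>)
      have "sup_norm (apply_bcontfun (z \<epsilon>)) \<le> norm (z \<epsilon>)"
        by (rule sup_norm_le) (rule norm_bounded)
      also have "\<dots> \<le> C * \<bar>\<epsilon>\<bar>" using zq[OF elim] by blast
      finally show ?case using sup_norm_nonneg[OF in_bdd, of "z \<epsilon>"] by (simp add: X_def)
    qed
    show "((\<lambda>\<epsilon>. C * \<bar>\<epsilon>\<bar>) \<longlongrightarrow> 0) (at 0)"
      by (auto intro!: tendsto_eq_intros)
  qed
  ultimately show ?thesis using \<epsilon>\<^sub>0 by blast
qed

end
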